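(* For any $r\ge1$, $\mathbf k=(k_1,\dots,k_r)\in\mathbb Z^r$ and $t\in(0,1)$, we have $$\widehat\zeta^{\,\rm des}_r(\mathbf k)(t)=\sum_{q\ge0}(-1)^q\frac{(\log t)^q}{q!}\sum_{\substack{\mathbf l=(l_j)\in\mathbb N_0^r\\ \mathbf m=(m_j)\in\mathbb Z^r\\ |\mathbf m|=-q}}a^r_{\mathbf l,\mathbf m}(q)\left(\prod_{j=1}^r(k_j)_{l_j}\right){\rm Li}_{\mathbf k+\mathbf m}(t).$$
   Context: **Notation.** $|\mathbf m|:=m_1+\cdots+m_r$; $(s)_0:=1$ and $(s)_k:=s(s+1)\cdots(s+k-1)$ (Pochhammer symbol). For $\mathbf k\in\mathbb Z^r$ and $|t|<1$, ${\rm Li}_{k_1,\dots,k_r}(t):=\sum_{0<n_1<\cdots<n_r}\frac{t^{n_r}}{n_1^{k_1}\cdots n_r^{k_r}}$ (multiple polylogarithm). **Coefficients.** For indeterminates $u_j,v_j$ ($1\le j\le r$) and the convention $v_0^{-1}:=0$, let $$\mathcal G_r:=\prod_{j=1}^r\{1-(u_jv_j+\cdots+u_rv_r)(v_j^{-1}-v_{j-1}^{-1})\}.$$ For $q\ge0$ the integers $a^r_{\mathbf l,\mathbf m}(q)$ are defined by $$\left(v_r^{-1}\frac{\partial}{\partial u_r}\right)^q[\mathcal G_r]=\sum_{\substack{\mathbf l\in\mathbb N_0^r,\ \mathbf m\in\mathbb Z^r\\ |\mathbf m|=-q}}a^r_{\mathbf l,\mathbf m}(q)\prod_{j=1}^ru_j^{l_j}v_j^{m_j}$$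 (for $q>r$ the left-hand side is $0$, so all $a^r_{\mathbf l,\mathbf m}(q)$ vanish and the sum over $q$ is finite). **The function $\widehat\zeta^{\,\rm des}_r$.** For $s_1,\dots,s_r\in\mathbb C\setminus\mathbb Z$ and $0<t<1$, $$\widehat\zeta^{\,\rm des}_r(s_1,\dots,s_r)(t):=\prod_{k=1}^r\frac{1}{(e^{2\pi i s_k}-1)\Gamma(s_k)}\int_{\mathcal C^r}\prod_{j=1}^r\left(\frac{1}{\frac1t\exp(\sum_{k=j}^rx_k)-1}+\frac{(\log t-\sum_{k=j}^rx_k)\frac1t\exp(\sum_{k=j}^rx_k)}{\{\frac1t\exp(\sum_{k=j}^rx_k)-1\}^2}\right)\prod_{k=1}^rx_k^{s_k-1}dx_k,$$ where $\mathcal C$ is the Hankel contour: the positive real axis (top side, coming from $+\infty$), a circle around the origin of sufficiently small radius $\epsilon$ (counterclockwise), and the positive real axis (bottom side, going to $+\infty$). For each $t\in(0,1)$ this function extends to an entire function of $(s_1,\dots,s_r)\in\mathbb C^r$; values at integer points are those of the extension. *)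

theory Defs
  imports "HOL-Analysis.Analysis" "HOL-Library.Poly_Mapping"
begin

text \<open>An \<open>r\<close>-tuple \<open>(x\<^sub>1, \<dots>, x\<^sub>r)\<close> is a function on \<^typ>\<open>nat\<close> of which only the values on
  \<open>{1..r}\<close> matter.\<close>

definition multi_polylog :: "nat \<Rightarrow> (nat \<Rightarrow> int) \<Rightarrow> complex \<Rightarrow> complex" where
  "multi_polylog r k t =
     (\<Sum>\<^sub>\<infinity>n\<in>{n \<in> {1..r} \<rightarrow>\<^sub>E {0<..}. strict_mono_on {1..r} n}.
        t ^ n r / (\<Prod>j=1..r. of_nat (n j) powi k j))"

text \<open>Laurent polynomials over the integers: a pair \<open>(l, m)\<close> of exponent vectors stands for
  the monomial \<open>\<Prod>\<^sub>j u\<^sub>j\<^bsup>l\<^sub>j\<^esup> v\<^sub>j\<^bsup>m\<^sub>j\<^esup>\<close>, and the product of \<^type>\<open>poly_mapping\<close> is convolution.\<close>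

type_synonym expo = "(nat \<Rightarrow>\<^sub>0 nat) \<times> (nat \<Rightarrow>\<^sub>0 int)"
type_synonym laurent = "expo \<Rightarrow>\<^sub>0 int"

definition U :: "nat \<Rightarrow> laurent" where
  "U j = Poly_Mapping.single (Poly_Mapping.single j 1, 0) 1"

definition V :: "nat \<Rightarrow> laurent" where
  "V j = Poly_Mapping.single (0, Poly_Mapping.single j 1) 1"

text \<open>The inverse of \<open>v\<^sub>j\<close>, with the convention that it is \<open>0\<close> for \<open>j = 0\<close>.\<close>

definition Vinv :: "nat \<Rightarrow> laurent" where
  "Vinv j = (if j = 0 then 0 else Poly_Mapping.single (0, Poly_Mapping.single j (-1)) 1)"

definition deriv_U :: "nat \<Rightarrow> laurent \<Rightarrow> laurent" where
  "deriv_U j P = (\<Sum>(l, m)\<in>Poly_Mapping.keys P.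
     Poly_Mapping.single (l - Poly_Mapping.single j 1, m)
       (of_nat (Poly_Mapping.lookup l j) * Poly_Mapping.lookup P (l, m)))"

definition gen_G :: "nat \<Rightarrow> laurent" where
  "gen_G r = (\<Prod>j=1..r. 1 - (\<Sum>i=j..r. U i * V i) * (Vinv j - Vinv (j - 1)))"

definition coeff_a :: "nat \<Rightarrow> nat \<Rightarrow> expo \<Rightarrow> int" where
  "coeff_a r q = Poly_Mapping.lookup (((\<lambda>P. Vinv r * deriv_U r P) ^^ q) (gen_G r))"

definition expos :: "nat \<Rightarrow> nat \<Rightarrow> expo set" where
  "expos r q = {(l, m). Poly_Mapping.keys l \<subseteq> {1..r} \<and> Poly_Mapping.keys m \<subseteq> {1..r} \<and>
     (\<Sum>j=1..r. Poly_Mapping.lookup m j) = - int q}"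

text \<open>The Hankel contour is parametrised by \<open>\<tau> \<in> \<real>\<close>: for \<open>\<tau> < 0\<close> the top side
  \<open>x = \<epsilon> - \<tau>\<close>, for \<open>0 \<le> \<tau> \<le> 2\<pi>\<close> the circle \<open>x = \<epsilon> e\<^bsup>i\<tau>\<^esup>\<close>, and for \<open>\<tau> > 2\<pi>\<close> the bottom side
  \<open>x = \<epsilon> + \<tau> - 2\<pi>\<close>. The function \<open>hankel_log\<close> is the continuous logarithm along the contour,
  with imaginary part running from \<open>0\<close> to \<open>2\<pi>\<close>; it fixes the branch
  \<open>x\<^bsup>s-1\<^esup> = exp ((s - 1) log x)\<close>.\<close>

definition hankel_log :: "real \<Rightarrow> real \<Rightarrow> complex" where
  "hankel_log \<epsilon> \<tau> =
     (if \<tau> < 0 then Complex (ln (\<epsilon> - \<tau>)) 0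
      else if \<tau> \<le> 2 * pi then Complex (ln \<epsilon>) \<tau>
      else Complex (ln (\<epsilon> + \<tau> - 2 * pi)) (2 * pi))"

definition hankel :: "real \<Rightarrow> real \<Rightarrow> complex" where
  "hankel \<epsilon> \<tau> = exp (hankel_log \<epsilon> \<tau>)"

definition des_factor :: "real \<Rightarrow> complex \<Rightarrow> complex" where
  "des_factor t X =
     1 / (1 / of_real t * exp X - 1)
     + (of_real (ln t) - X) * (1 / of_real t * exp X) / (1 / of_real t * exp X - 1)\<^sup>2"

text \<open>The integral over the \<open>r\<close>-fold product of the contour with circle of radius \<open>\<epsilon>\<close>, pulled back
  along the parametrisation; \<^const>\<open>vector_derivative\<close> is undefined only at the two corners
  \<open>\<tau> = 0\<close> and \<open>\<tau> = 2\<pi>\<close>.\<close>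

definition hankel_integral :: "nat \<Rightarrow> (nat \<Rightarrow> complex) \<Rightarrow> real \<Rightarrow> real \<Rightarrow> complex" where
  "hankel_integral r s t \<epsilon> =
     (LINT \<tau>|Pi\<^sub>M {1..r} (\<lambda>_. lborel).
        (\<Prod>j=1..r. des_factor t (\<Sum>k=j..r. hankel \<epsilon> (\<tau> k))) *
        (\<Prod>k=1..r. exp ((s k - 1) * hankel_log \<epsilon> (\<tau> k)) *
                   vector_derivative (hankel \<epsilon>) (at (\<tau> k))))"

text \<open>``Sufficiently small radius'': the common value for all small \<open>\<epsilon> > 0\<close>.\<close>

definition zeta_des_nonint :: "nat \<Rightarrow> (nat \<Rightarrow> complex) \<Rightarrow> real \<Rightarrow> complex" where
  "zeta_des_nonint r s t =
     (\<Prod>k=1..r. 1 / ((exp (2 * of_real pi * \<i> * s k) - 1) * Gamma (s k))) *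
     (THE w. \<forall>\<^sub>F \<epsilon> in at_right 0. hankel_integral r s t \<epsilon> = w)"

text \<open>\<open>\<complex>\<^sup>r\<close> is the set of functions extensional on \<open>{1..r}\<close>, with the product topology of the
  function type. An entire function of \<open>r\<close> variables is a continuous function on \<open>\<complex>\<^sup>r\<close>
  that is holomorphic in each variable separately.\<close>

definition entire_on_Cr :: "nat \<Rightarrow> ((nat \<Rightarrow> complex) \<Rightarrow> complex) \<Rightarrow> bool" where
  "entire_on_Cr r F \<longleftrightarrow>
     continuous_on ({1..r} \<rightarrow>\<^sub>E UNIV) F \<and>
     (\<forall>s \<in> {1..r} \<rightarrow>\<^sub>E UNIV. \<forall>j\<in>{1..r}. (\<lambda>z. F (s(j := z))) holomorphic_on UNIV)"

text \<open>The entire extension, which is unique on \<open>\<complex>\<^sup>r\<close> because the points with no integer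
  coordinate are dense.\<close>

definition zeta_des :: "nat \<Rightarrow> (nat \<Rightarrow> complex) \<Rightarrow> real \<Rightarrow> complex" where
  "zeta_des r s t =
     (SOME F. entire_on_Cr r F \<and>
        (\<forall>z \<in> {1..r} \<rightarrow>\<^sub>E (- \<int>). F z = zeta_des_nonint r z t)) (restrict s {1..r})"

end

theory Submission
  imports Defs "HOL-Complex_Analysis.Complex_Analysis" "HOL-Real_Asymp.Real_Asymp"
begin

text \<open>On the Hankel contour the real part of \<open>X\<^sub>j = x\<^sub>j + \<dots> + x\<^sub>r\<close> exceeds \<open>log t\<close>, so the \<open>j\<close>-th factor is
  \<open>\<Sum>\<^sub>n t\<^sup>n e\<^bsup>-nX\<^sub>j\<^esup> (1 + n (log t - X\<^sub>j))\<close>, a sum over \<open>n \<ge> 1\<close>. In terms of the partial sums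
  \<open>n\<^sub>1 < \<dots> < n\<^sub>r\<close> of the summation indices, the product of the factors becomes a sum over strictly
  increasing tuples, whose polynomial part \<open>\<Prod>\<^sub>j (1 + (n\<^sub>j - n\<^sub>j\<^sub>-\<^sub>1) (log t - X\<^sub>j))\<close> is the value of
  \<open>\<G>\<^sub>r\<close> at \<open>v\<^sub>j = 1 / n\<^sub>j\<close> and \<open>u\<^sub>j = n\<^sub>j x\<^sub>j\<close>, with \<open>u\<^sub>r\<close> shifted by \<open>- v\<^sub>r\<^sup>-\<^sup>1 log t\<close>.
  Taylor's formula for this shift produces the operators \<open>(v\<^sub>r\<^sup>-\<^sup>1 \<partial>/\<partial>u\<^sub>r)\<^sup>q\<close>, and Hankel's formula for the
  Gamma function integrates every monomial: \<open>x\<^sup>l e\<^bsup>-nx\<^esup>\<close> contributes \<open>(s)\<^sub>l n\<^bsup>-s-l\<^esup>\<close>. The resulting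
  combination of polylogarithms is entire in \<open>s\<close>, so it is also the value at integer points.\<close>

subsection \<open>Evaluation of Laurent polynomials\<close>

text \<open>Only u_r is shifted because every X_j contains x_r: subtracting log t from x_r alone
  subtracts it from all X_j at once, and since u_r v_r = x_r this is a shift of u_r by a multiple of
  v_r^{-1}. The difference v_j^{-1} - v_{j-1}^{-1} becomes n_j - n_{j-1}, the summation index of the
  j-th factor. The obstacle is the exchange of the sum over tuples with an r-fold integral over an
  unbounded contour. The single condition r * eps < - log t settles it: since Re x >= - eps on the
  contour, it yields Re X_j > log t, and it makes the majorant sum over t^{n_r} * prod_j e^{eps n_j}
  n_j^p converge because n_j <= n_r. For a fixed tuple and monomial the integrand is a product of
  one-variable functions, so only one-variable Hankel integrals have to be computed. At an integer
  point the value of the extension is read off as a limit along points without integer coordinates,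
  where both sides are known to agree.\<close>

definition laurent_monom :: "nat \<Rightarrow> (nat \<Rightarrow> complex) \<Rightarrow> (nat \<Rightarrow> complex) \<Rightarrow> expo \<Rightarrow> complex" where
  "laurent_monom r u v e =
     (\<Prod>j=1..r. u j ^ Poly_Mapping.lookup (fst e) j * v j powi Poly_Mapping.lookup (snd e) j)"

definition laurent_eval :: "nat \<Rightarrow> (nat \<Rightarrow> complex) \<Rightarrow> (nat \<Rightarrow> complex) \<Rightarrow> laurent \<Rightarrow> complex" where
  "laurent_eval r u v P =
     (\<Sum>e\<in>Poly_Mapping.keys P. of_int (Poly_Mapping.lookup P e) * laurent_monom r u v e)"

text \<open>Exponents of opposite sign may cancel in \<open>a + b\<close>. At v j = 0 the law would
  fail for 1 and -1: the sum gives \<open>0 powi 0 = 1\<close>, the product gives 0.\<close>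

lemma laurent_monom_add:
  assumes "\<forall>j\<in>{1..r}. v j \<noteq> 0"
  shows "laurent_monom r u v (a + b) = laurent_monom r u v a * laurent_monom r u v b"
  unfolding laurent_monom_def prod.distrib[symmetric]
  using assms by (intro prod.cong) (auto simp: lookup_add power_add power_int_add)

lemma laurent_monom_0 [simp]: "laurent_monom r u v 0 = 1"
  by (simp add: laurent_monom_def)

text \<open>Cancellation can shrink the key set of a sum, so additivity is proved over one finite
  set that contains the keys of both summands and of their sum.\<close>

lemma laurent_eval_superset:
  assumes "finite A" "Poly_Mapping.keys P \<subseteq> A"
  shows "laurent_eval r u v P = (\<Sum>e\<in>A. of_int (Poly_Mapping.lookup P e) * laurent_monom r u v e)"
  unfolding laurent_eval_def using assms
  by (intro sum.mono_neutral_left) (auto simp: in_keys_iff)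

lemma laurent_eval_0 [simp]: "laurent_eval r u v 0 = 0"
  by (simp add: laurent_eval_def)

lemma laurent_eval_single:
  "laurent_eval r u v (Poly_Mapping.single e c) = of_int c * laurent_monom r u v e"
  by (subst laurent_eval_superset[of "{e}"]) auto

lemma laurent_eval_1 [simp]: "laurent_eval r u v 1 = 1"
  by (metis laurent_eval_single laurent_monom_0 of_int_1 mult_1 single_one)

lemma laurent_eval_add:
  "laurent_eval r u v (P + Q) = laurent_eval r u v P + laurent_eval r u v Q"
proof -
  let ?A = "Poly_Mapping.keys P \<union> Poly_Mapping.keys Q"
  have "laurent_eval r u v R = (\<Sum>e\<in>?A. of_int (Poly_Mapping.lookup R e) * laurent_monom r u v e)"
    if "R \<in> {P, Q, P + Q}" for R
    using that by (intro laurent_eval_superset) (auto dest: subsetD[OF Poly_Mapping.keys_add])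
  thus ?thesis
    by (simp add: lookup_add algebra_simps sum.distrib)
qed

lemma laurent_eval_uminus: "laurent_eval r u v (- P) = - laurent_eval r u v P"
  using laurent_eval_add[of r u v P "- P"] by (simp add: eq_neg_iff_add_eq_0 add.commute)

lemma laurent_eval_diff:
  "laurent_eval r u v (P - Q) = laurent_eval r u v P - laurent_eval r u v Q"
  using laurent_eval_add[of r u v P "- Q"] by (simp add: laurent_eval_uminus)

lemma laurent_eval_sum:
  "laurent_eval r u v (\<Sum>i\<in>I. f i) = (\<Sum>i\<in>I. laurent_eval r u v (f i))"
  by (induction I rule: infinite_finite_induct) (auto simp: laurent_eval_add)

text \<open>Reduces every additive statement about Laurent polynomials to single monomials.\<close>

lemma laurent_expansion:
  fixes P :: laurent
  shows "P = (\<Sum>e\<in>Poly_Mapping.keys P. Poly_Mapping.single e (Poly_Mapping.lookup P e))"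
proof (rule poly_mapping_eqI)
  fix e
  show "Poly_Mapping.lookup P e = Poly_Mapping.lookup
      (\<Sum>e\<in>Poly_Mapping.keys P. Poly_Mapping.single e (Poly_Mapping.lookup P e)) e"
    by (simp add: lookup_sum lookup_single when_def in_keys_iff)
qed

lemma laurent_eval_mult:
  assumes "\<forall>j\<in>{1..r}. v j \<noteq> 0"
  shows "laurent_eval r u v (P * Q) = laurent_eval r u v P * laurent_eval r u v Q"
proof -
  have "laurent_eval r u v (P * Q) = laurent_eval r u v
     ((\<Sum>e\<in>Poly_Mapping.keys P. Poly_Mapping.single e (Poly_Mapping.lookup P e)) *
      (\<Sum>e\<in>Poly_Mapping.keys Q. Poly_Mapping.single e (Poly_Mapping.lookup Q e)))"
    by (simp only: laurent_expansion[of P, symmetric] laurent_expansion[of Q, symmetric])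
  also have "\<dots> = laurent_eval r u v P * laurent_eval r u v Q"
    unfolding sum_product laurent_eval_sum mult_single laurent_eval_single
    by (simp add: laurent_eval_def sum_product laurent_monom_add[OF assms] mult_ac)
  finally show ?thesis .
qed

lemma laurent_eval_prod:
  assumes "\<forall>j\<in>{1..r}. v j \<noteq> 0"
  shows "laurent_eval r u v (\<Prod>i\<in>I. f i) = (\<Prod>i\<in>I. laurent_eval r u v (f i))"
  by (induction I rule: infinite_finite_induct) (auto simp: laurent_eval_mult[OF assms])

lemma laurent_monom_U:
  assumes "j \<in> {1..r}"
  shows "laurent_monom r u v (Poly_Mapping.single j 1, 0) = u j"
proof -
  have "laurent_monom r u v (Poly_Mapping.single j 1, 0) = (\<Prod>i=1..r. if i = j then u i else 1)"
    unfolding laurent_monom_def by (intro prod.cong) (auto simp: lookup_single when_def)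
  thus ?thesis using assms by simp
qed

lemma laurent_monom_V:
  assumes "j \<in> {1..r}"
  shows "laurent_monom r u v (0, Poly_Mapping.single j n) = v j powi n"
proof -
  have "laurent_monom r u v (0, Poly_Mapping.single j n) = (\<Prod>i=1..r. if i = j then v i powi n else 1)"
    unfolding laurent_monom_def by (intro prod.cong) (auto simp: lookup_single when_def)
  thus ?thesis using assms by simp
qed

lemma laurent_eval_U: "j \<in> {1..r} \<Longrightarrow> laurent_eval r u v (U j) = u j"
  unfolding U_def laurent_eval_single by (subst laurent_monom_U) simp_all

lemma laurent_eval_V: "j \<in> {1..r} \<Longrightarrow> laurent_eval r u v (V j) = v j"
  unfolding V_def laurent_eval_single by (subst laurent_monom_V) simp_all

lemma laurent_eval_Vinv:
  "j \<in> {0..r} \<Longrightarrow> laurent_eval r u v (Vinv j) = (if j = 0 then 0 else inverse (v j))"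
  by (auto simp: Vinv_def laurent_eval_single laurent_monom_V power_int_minus)

lemma laurent_eval_gen_G:
  assumes "\<forall>j\<in>{1..r}. v j \<noteq> 0"
  shows "laurent_eval r u v (gen_G r) =
    (\<Prod>j=1..r. 1 - (\<Sum>i=j..r. u i * v i) *
       (inverse (v j) - (if j = 1 then 0 else inverse (v (j - 1)))))"
  unfolding gen_G_def laurent_eval_prod[OF assms]
  by (intro prod.cong)
     (auto simp: laurent_eval_diff laurent_eval_mult[OF assms] laurent_eval_sum
        laurent_eval_U laurent_eval_V laurent_eval_Vinv)

section \<open>The operator v_r^{-1} d/du_r and Taylor's formula\<close>

definition vderiv :: "nat \<Rightarrow> laurent \<Rightarrow> laurent" where
  "vderiv r P = Vinv r * deriv_U r P"

lemma coeff_a_eq: "coeff_a r q = Poly_Mapping.lookup ((vderiv r ^^ q) (gen_G r))"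
  by (simp add: coeff_a_def vderiv_def[abs_def])

lemma vderiv_superset:
  assumes "finite A" "Poly_Mapping.keys P \<subseteq> A"
  shows "vderiv r P = (\<Sum>e\<in>A. Vinv r * Poly_Mapping.single (fst e - Poly_Mapping.single r 1, snd e)
       (of_nat (Poly_Mapping.lookup (fst e) r) * Poly_Mapping.lookup P e))"
  unfolding vderiv_def deriv_U_def sum_distrib_left case_prod_unfold prod.collapse using assms
  by (intro sum.mono_neutral_left) (auto simp: in_keys_iff)

lemma vderiv_add: "vderiv r (P + Q) = vderiv r P + vderiv r Q"
proof -
  let ?A = "Poly_Mapping.keys P \<union> Poly_Mapping.keys Q"
  have "vderiv r R = (\<Sum>e\<in>?A. Vinv r * Poly_Mapping.single (fst e - Poly_Mapping.single r 1, snd e)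
       (of_nat (Poly_Mapping.lookup (fst e) r) * Poly_Mapping.lookup R e))"
    if "R \<in> {P, Q, P + Q}" for R
    using that by (intro vderiv_superset) (auto dest: subsetD[OF Poly_Mapping.keys_add])
  thus ?thesis
    by (simp add: lookup_add distrib_left single_add sum.distrib)
qed

lemma vderiv_0 [simp]: "vderiv r 0 = 0"
  by (simp add: vderiv_def deriv_U_def)

lemma vderiv_funpow_sum: "(vderiv r ^^ q) (\<Sum>i\<in>I. f i) = (\<Sum>i\<in>I. (vderiv r ^^ q) (f i))"
proof (induction q)
  case (Suc q)
  have "vderiv r (\<Sum>i\<in>I. g i) = (\<Sum>i\<in>I. vderiv r (g i))" for g
    by (induction I rule: infinite_finite_induct) (auto simp: vderiv_add)
  with Suc show ?case by simp
qed simp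

text \<open>If u_r does not occur in the monomial, the truncated difference of exponents is wrong,
  but then the coefficient \<open>lookup (fst e) r\<close> is 0.\<close>

lemma vderiv_single:
  assumes "r \<ge> 1"
  shows "vderiv r (Poly_Mapping.single e c) =
    Poly_Mapping.single (fst e - Poly_Mapping.single r 1, snd e - Poly_Mapping.single r 1)
       (of_nat (Poly_Mapping.lookup (fst e) r) * c)"
proof -
  have "vderiv r (Poly_Mapping.single e c) = Vinv r *
      Poly_Mapping.single (fst e - Poly_Mapping.single r 1, snd e)
       (of_nat (Poly_Mapping.lookup (fst e) r) * c)"
    by (subst vderiv_superset[of "{e}"]) auto
  also have "\<dots> = Poly_Mapping.single (fst e - Poly_Mapping.single r 1, snd e - Poly_Mapping.single r 1)
       (of_nat (Poly_Mapping.lookup (fst e) r) * c)"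
    using assms by (simp add: Vinv_def mult_single single_uminus)
  finally show ?thesis .
qed

text \<open>The integer \<open>fact q * (l choose q)\<close> is the falling factorial l (l-1) ...
  (l-q+1). In this form the 1/q! of Taylor's formula leaves a binomial coefficient, and the case q >
  l, where exponents are truncated, has coefficient 0.\<close>

lemma vderiv_funpow_single:
  assumes "r \<ge> 1"
  shows "(vderiv r ^^ q) (Poly_Mapping.single e c) =
    Poly_Mapping.single (fst e - Poly_Mapping.single r q, snd e - Poly_Mapping.single r (int q))
       (of_nat (fact q * (Poly_Mapping.lookup (fst e) r choose q)) * c)"
proof (induction q)
  case (Suc q)
  let ?l = "Poly_Mapping.lookup (fst e) r"
  have "fact q * (?l choose q) * (?l - q) = fact (Suc q) * (?l choose Suc q)"
  proof -
    have "Suc q * (?l choose Suc q) = (?l - q) * (?l choose q)"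
      by (simp only: binomial_absorb_comp binomial_absorption)
    thus ?thesis by (metis fact_Suc mult.assoc mult.commute of_nat_id)
  qed
  hence *: "(of_nat (fact q * (?l choose q)) * (of_nat (?l - q))) = (of_nat (fact (Suc q) * (?l choose Suc q)) :: int)"
    by (metis of_nat_mult)
  have l: "fst e - Poly_Mapping.single r q - Poly_Mapping.single r 1 = fst e - Poly_Mapping.single r (Suc q)"
    by (rule poly_mapping_eqI) (simp add: lookup_minus lookup_single when_def)
  have m: "snd e - Poly_Mapping.single r (int q) - Poly_Mapping.single r 1 = snd e - Poly_Mapping.single r (int (Suc q))"
    by (rule poly_mapping_eqI) (simp add: lookup_minus lookup_single when_def)
  have c: "of_nat (Poly_Mapping.lookup (fst e - Poly_Mapping.single r q) r) *
      (of_nat (fact q * (?l choose q)) * c) = of_nat (fact (Suc q) * (?l choose Suc q)) * c"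
    unfolding *[symmetric] by (simp add: lookup_minus)
  have "(vderiv r ^^ Suc q) (Poly_Mapping.single e c) =
      vderiv r ((vderiv r ^^ q) (Poly_Mapping.single e c))"
    by simp
  also note Suc
  also note vderiv_single[OF assms]
  finally show ?case unfolding fst_conv snd_conv l m c .
qed simp

text \<open>This is the binomial theorem for (u_r + z / v_r)^l: each application of the operator
  contributes one v_r^{-1}, which pairs with one z. Terms with q > l vanish, so any cutoff
  \<open>d\<close> above the exponent is allowed, and one cutoff can serve all monomials of a
  polynomial.\<close>

lemma laurent_taylor_single:
  assumes r: "r \<ge> 1" and v: "\<forall>j\<in>{1..r}. v j \<noteq> 0"
    and d: "Poly_Mapping.lookup (fst e) r \<le> d"
  shows "(\<Sum>q\<le>d. z ^ q / fact q * laurent_eval r u v ((vderiv r ^^ q) (Poly_Mapping.single e c))) =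
    laurent_eval r (u(r := u r + z / v r)) v (Poly_Mapping.single e c)"
proof -
  let ?l = "Poly_Mapping.lookup (fst e) r"
  \<comment> \<open>The factors in the variables other than u_r and v_r, together untouched by both
    the operator and the shift.\<close>
  define M where "M = (\<Prod>j\<in>{1..r}-{r}. u j ^ Poly_Mapping.lookup (fst e) j * v j powi Poly_Mapping.lookup (snd e) j)"
  have split: "prod f {1..r} = f r * prod f ({1..r}-{r})" for f :: "nat \<Rightarrow> complex"
    using r by (intro prod.remove) auto
  have vr: "v r \<noteq> 0" using v r by auto
  have mono: "laurent_monom r u v (fst e - Poly_Mapping.single r q, snd e - Poly_Mapping.single r (int q))
     = u r ^ (?l - q) * v r powi (Poly_Mapping.lookup (snd e) r) / v r ^ q * M" if "q \<le> ?l" for q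
    unfolding laurent_monom_def split M_def fst_conv snd_conv lookup_minus
    using vr by (simp add: lookup_single power_int_diff)
  have "(\<Sum>q\<le>d. z ^ q / fact q * laurent_eval r u v ((vderiv r ^^ q) (Poly_Mapping.single e c)))
     = (\<Sum>q\<le>d. of_nat (?l choose q) * z ^ q * of_int c * 
        laurent_monom r u v (fst e - Poly_Mapping.single r q, snd e - Poly_Mapping.single r (int q)))"
    unfolding vderiv_funpow_single[OF r] laurent_eval_single by (simp add: mult_ac)
  also have "\<dots> = (\<Sum>q\<le>?l. of_nat (?l choose q) * z ^ q * of_int c * 
        laurent_monom r u v (fst e - Poly_Mapping.single r q, snd e - Poly_Mapping.single r (int q)))"
    using d by (intro sum.mono_neutral_right) auto
  also have "\<dots> = (\<Sum>q\<le>?l. of_nat (?l choose q) * (z / v r) ^ q * u r ^ (?l - q)) *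
        (of_int c * v r powi (Poly_Mapping.lookup (snd e) r) * M)"
    unfolding sum_distrib_right by (intro sum.cong refl) (simp add: mono field_simps)
  also have "(\<Sum>q\<le>?l. of_nat (?l choose q) * (z / v r) ^ q * u r ^ (?l - q)) = (u r + z / v r) ^ ?l"
    by (subst add.commute) (simp add: binomial_ring)
  also have "(u r + z / v r) ^ ?l * (of_int c * v r powi (Poly_Mapping.lookup (snd e) r) * M) =
    laurent_eval r (u(r := u r + z / v r)) v (Poly_Mapping.single e c)"
    unfolding laurent_eval_single laurent_monom_def split M_def by simp
  finally show ?thesis .
qed

lemma laurent_taylor:
  assumes r: "r \<ge> 1" and v: "\<forall>j\<in>{1..r}. v j \<noteq> 0"
    and d: "\<forall>e\<in>Poly_Mapping.keys P. Poly_Mapping.lookup (fst e) r \<le> d"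
  shows "(\<Sum>q\<le>d. z ^ q / fact q * laurent_eval r u v ((vderiv r ^^ q) P)) =
    laurent_eval r (u(r := u r + z / v r)) v P"
proof -
  let ?P = "\<lambda>e. Poly_Mapping.single e (Poly_Mapping.lookup P e)"
  have "(\<Sum>q\<le>d. z ^ q / fact q * laurent_eval r u v ((vderiv r ^^ q) P)) =
    (\<Sum>q\<le>d. z ^ q / fact q * laurent_eval r u v ((vderiv r ^^ q) (\<Sum>e\<in>Poly_Mapping.keys P. ?P e)))"
    by (simp only: laurent_expansion[of P, symmetric])
  also have "\<dots> = (\<Sum>e\<in>Poly_Mapping.keys P. \<Sum>q\<le>d. z ^ q / fact q * laurent_eval r u v ((vderiv r ^^ q) (?P e)))"
    unfolding vderiv_funpow_sum laurent_eval_sum sum_distrib_left by (rule sum.swap)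
  also have "\<dots> = (\<Sum>e\<in>Poly_Mapping.keys P. laurent_eval r (u(r := u r + z / v r)) v (?P e))"
    using d by (intro sum.cong refl laurent_taylor_single r v) auto
  also have "\<dots> = laurent_eval r (u(r := u r + z / v r)) v P"
    unfolding laurent_eval_sum[symmetric] by (simp only: laurent_expansion[of P, symmetric])
  finally show ?thesis .
qed

text \<open>Each application lowers the degree in u_r, which makes the sum over q in the theorem
  finite.\<close>

lemma vderiv_funpow_eq_0:
  assumes r: "r \<ge> 1" and d: "\<And>e. e \<in> Poly_Mapping.keys P \<Longrightarrow> Poly_Mapping.lookup (fst e) r < q"
  shows "(vderiv r ^^ q) P = 0"
proof -
  have "(vderiv r ^^ q) P = (\<Sum>e\<in>Poly_Mapping.keys P. (vderiv r ^^ q) (Poly_Mapping.single e (Poly_Mapping.lookup P e)))"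
    by (simp only: vderiv_funpow_sum[symmetric] laurent_expansion[of P, symmetric])
  also have "\<dots> = 0"
    using d by (intro sum.neutral ballI) (simp add: vderiv_funpow_single[OF r] binomial_eq_0)
  finally show ?thesis .
qed

section \<open>Homogeneity in the variables v_j\<close>

definition weight_expos :: "nat \<Rightarrow> int \<Rightarrow> expo set" where
  "weight_expos r w = {(l, m). Poly_Mapping.keys l \<subseteq> {1..r} \<and> Poly_Mapping.keys m \<subseteq> {1..r} \<and>
     (\<Sum>j=1..r. Poly_Mapping.lookup m j) = w}"

text \<open>Weight is the total degree in the v_j alone. The set \<open>expos r q\<close> is the
  case of weight -q, but the building blocks of G_r also have weights 1 and -1. Zero belongs to
  every weight, which accommodates \<open>Vinv 0\<close>.\<close>

definition homogeneous :: "nat \<Rightarrow> int \<Rightarrow> laurent set" where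
  "homogeneous r w = {P. Poly_Mapping.keys P \<subseteq> weight_expos r w}"

lemma homogeneousD:
  assumes "P \<in> homogeneous r w" "(l, m) \<in> Poly_Mapping.keys P"
  shows "Poly_Mapping.keys l \<subseteq> {1..r}" "Poly_Mapping.keys m \<subseteq> {1..r}"
    "(\<Sum>j=1..r. Poly_Mapping.lookup m j) = w"
proof -
  have "(l, m) \<in> weight_expos r w"
    using assms unfolding homogeneous_def by blast
  thus "Poly_Mapping.keys l \<subseteq> {1..r}" "Poly_Mapping.keys m \<subseteq> {1..r}"
    "(\<Sum>j=1..r. Poly_Mapping.lookup m j) = w"
    by (simp_all add: weight_expos_def)
qed

lemma homogeneous_0 [simp]: "0 \<in> homogeneous r w"
  by (simp add: homogeneous_def)

lemma homogeneous_single: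
  "Poly_Mapping.keys l \<subseteq> {1..r} \<Longrightarrow> Poly_Mapping.keys m \<subseteq> {1..r} \<Longrightarrow>
   (\<Sum>j=1..r. Poly_Mapping.lookup m j) = w \<Longrightarrow> Poly_Mapping.single (l, m) c \<in> homogeneous r w"
  by (simp add: homogeneous_def weight_expos_def)

lemma homogeneous_add:
  "P \<in> homogeneous r w \<Longrightarrow> Q \<in> homogeneous r w \<Longrightarrow> P + Q \<in> homogeneous r w"
  unfolding homogeneous_def using Poly_Mapping.keys_add[of P Q] by blast

lemma homogeneous_diff:
  "P \<in> homogeneous r w \<Longrightarrow> Q \<in> homogeneous r w \<Longrightarrow> P - Q \<in> homogeneous r w"
  unfolding homogeneous_def using keys_diff[of P Q] by blast

lemma homogeneous_sum:
  "(\<And>i. i \<in> I \<Longrightarrow> f i \<in> homogeneous r w) \<Longrightarrow> (\<Sum>i\<in>I. f i) \<in> homogeneous r w"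
  by (induction I rule: infinite_finite_induct) (auto intro: homogeneous_add)

lemma homogeneous_mult:
  assumes P: "P \<in> homogeneous r w" and Q: "Q \<in> homogeneous r w'"
  shows "P * Q \<in> homogeneous r (w + w')"
proof -
  { fix l m l' m'
    assume A: "(l, m) \<in> Poly_Mapping.keys P" "(l', m') \<in> Poly_Mapping.keys Q"
    have "Poly_Mapping.keys (l + l') \<subseteq> {1..r}" "Poly_Mapping.keys (m + m') \<subseteq> {1..r}"
      "(\<Sum>j=1..r. Poly_Mapping.lookup (m + m') j) = w + w'"
    proof -
      note B = homogeneousD[OF P A(1)] homogeneousD[OF Q A(2)]
      show "Poly_Mapping.keys (l + l') \<subseteq> {1..r}" "Poly_Mapping.keys (m + m') \<subseteq> {1..r}"
        using B(1,2,4,5) Poly_Mapping.keys_add[of l l'] Poly_Mapping.keys_add[of m m'] by blast+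
      show "(\<Sum>j=1..r. Poly_Mapping.lookup (m + m') j) = w + w'"
        unfolding lookup_add sum.distrib using B(3,6) by simp
    qed
  }
  note * = this
  show ?thesis unfolding homogeneous_def
  proof (clarify, goal_cases)
    case (1 l m)
    then obtain a b where "a \<in> Poly_Mapping.keys P" "b \<in> Poly_Mapping.keys Q" "(l, m) = a + b"
      using Poly_Mapping.keys_mult[of P Q] by blast
    with *[of "fst a" "snd a" "fst b" "snd b"] show ?case
      by (simp add: plus_prod_def weight_expos_def)
  qed
qed

lemma homogeneous_1: "1 \<in> homogeneous r 0"
  unfolding homogeneous_def by (simp add: zero_prod_def weight_expos_def)

lemma homogeneous_prod:
  "(\<And>i. i \<in> I \<Longrightarrow> f i \<in> homogeneous r 0) \<Longrightarrow> (\<Prod>i\<in>I. f i) \<in> homogeneous r 0"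
proof (induction I rule: infinite_finite_induct)
  case (insert i I)
  thus ?case using homogeneous_mult[of "f i" r 0 "prod f I" 0] by simp
qed (auto intro: homogeneous_1)

lemma sum_lookup_single:
  "(j::nat) \<in> {1..r} \<Longrightarrow> (\<Sum>i=1..r. Poly_Mapping.lookup (Poly_Mapping.single j (n::int)) i) = n"
  by (subst sum.remove[of _ j]) (auto intro!: sum.neutral simp: lookup_single when_def)

lemma homogeneous_U: "j \<in> {1..r} \<Longrightarrow> U j \<in> homogeneous r 0"
  unfolding U_def by (intro homogeneous_single) (auto split: if_splits)

lemma homogeneous_V: "j \<in> {1..r} \<Longrightarrow> V j \<in> homogeneous r 1"
  unfolding V_def by (intro homogeneous_single) (auto simp: sum_lookup_single split: if_splits)

lemma homogeneous_Vinv: "j \<le> r \<Longrightarrow> Vinv j \<in> homogeneous r (-1)"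
  unfolding Vinv_def using sum_lookup_single[of j r "-1"] by (auto intro!: homogeneous_single)

text \<open>In each factor the weight 1 of the sum of the u_i v_i cancels the weight -1 of the
  difference of inverses.\<close>

lemma homogeneous_gen_G: "gen_G r \<in> homogeneous r 0"
proof -
  have "(\<Sum>i=j..r. U i * V i) * (Vinv j - Vinv (j - 1)) \<in> homogeneous r 0" if "j \<in> {1..r}" for j
  proof -
    have "(\<Sum>i=j..r. U i * V i) \<in> homogeneous r 1"
      using that homogeneous_mult[OF homogeneous_U homogeneous_V]
      by (intro homogeneous_sum) (simp add: atLeastAtMost_iff)
    moreover have "Vinv j - Vinv (j - 1) \<in> homogeneous r (-1)"
      using that by (intro homogeneous_diff homogeneous_Vinv) auto
    ultimately show ?thesis using homogeneous_mult[of _ r 1 _ "-1"] by simp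
  qed
  thus ?thesis unfolding gen_G_def
    by (intro homogeneous_prod homogeneous_diff homogeneous_1)
qed

lemma homogeneous_vderiv:
  assumes P: "P \<in> homogeneous r w"
  shows "vderiv r P \<in> homogeneous r (w - 1)"
proof -
  have "Poly_Mapping.single (l - Poly_Mapping.single r 1, m) c \<in> homogeneous r w"
    if "(l, m) \<in> Poly_Mapping.keys P" for l m c
  proof (rule homogeneous_single)
    have "Poly_Mapping.keys (l - Poly_Mapping.single r 1) \<subseteq> Poly_Mapping.keys l"
      by (auto simp: in_keys_iff lookup_minus)
    thus "Poly_Mapping.keys (l - Poly_Mapping.single r 1) \<subseteq> {1..r}"
      using homogeneousD(1)[OF P that] by (rule order_trans)
  qed (use homogeneousD[OF P that] in simp_all)
  hence "deriv_U r P \<in> homogeneous r w"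
    unfolding deriv_U_def by (intro homogeneous_sum) auto
  from homogeneous_mult[OF homogeneous_Vinv[OF order_refl] this] show ?thesis
    by (simp add: vderiv_def)
qed

text \<open>Each operator lowers the weight by one through its factor v_r^{-1}. The inclusion is
  what allows the sum over the infinite set \<open>expos r q\<close> to be replaced by a sum over
  finitely many keys.\<close>

lemma keys_vderiv_gen_G: "Poly_Mapping.keys ((vderiv r ^^ q) (gen_G r)) \<subseteq> expos r q"
proof -
  have "(vderiv r ^^ q) (gen_G r) \<in> homogeneous r (- int q)"
  proof (induction q)
    case (Suc q)
    have "- int (Suc q) = - int q - 1" by simp
    with homogeneous_vderiv[OF Suc] show ?case by (simp only: funpow.simps o_apply)
  qed (use homogeneous_gen_G in auto)
  thus ?thesis by (simp add: homogeneous_def expos_def weight_expos_def)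
qed

subsection \<open>Sums over strictly increasing tuples\<close>

definition mono_tuples :: "nat \<Rightarrow> (nat \<Rightarrow> nat) set" where
  "mono_tuples r = {n \<in> {1..r} \<rightarrow>\<^sub>E {0<..}. strict_mono_on {1..r} n}"

text \<open>The convention n_0 = 0 matches v_0^{-1} = 0 in G_r; the value \<open>n 0\<close> itself
  lies outside the domain of an extensional tuple.\<close>

definition previous :: "(nat \<Rightarrow> nat) \<Rightarrow> nat \<Rightarrow> nat" where
  "previous n j = (if j = 1 then 0 else n (j - 1))"

lemma mono_tuples_pos: "n \<in> mono_tuples r \<Longrightarrow> j \<in> {1..r} \<Longrightarrow> n j > 0"
  by (auto simp: mono_tuples_def PiE_iff)

lemma mono_tuples_le: "n \<in> mono_tuples r \<Longrightarrow> j \<in> {1..r} \<Longrightarrow> n j \<le> n r"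
  by (auto simp: mono_tuples_def strict_mono_on_def intro: le_neq_implies_less less_imp_le)
    (metis le_eq_less_or_eq le_trans)

lemma mono_tuples_previous_less:
  assumes "n \<in> mono_tuples r" "j \<in> {1..r}"
  shows "previous n j < n j"
proof (cases "j = 1")
  case False
  hence "j - 1 \<in> {1..r}" "j - 1 < j" using assms(2) by auto
  hence "n (j - 1) < n j"
    using assms unfolding mono_tuples_def by (auto elim!: strict_mono_onD)
  thus ?thesis using False by (simp add: previous_def)
qed (use assms in \<open>auto simp: previous_def dest: mono_tuples_pos\<close>)

lemma countable_mono_tuples: "countable (mono_tuples r)"
proof (rule countable_subset)
  show "mono_tuples r \<subseteq> {1..r} \<rightarrow>\<^sub>E UNIV" unfolding mono_tuples_def PiE_def by blast
qed (auto intro: countable_PiE)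

lemma summable_on_exp_times_powr:
  fixes a p :: real
  assumes "a > 0"
  shows "(\<lambda>n::nat. exp (- a * n) * real n powr p) summable_on A"
proof -
  have "(\<lambda>n::nat. exp (- a * n) * real n powr p) \<in> O(\<lambda>n. real n powr (-2))"
    using assms by real_asymp
  moreover have "summable (\<lambda>n. norm (real n powr (-2)))"
    by (simp add: summable_real_powr_iff)
  ultimately have "summable (\<lambda>n::nat. exp (- a * n) * real n powr p)"
    by (rule summable_comparison_test_bigo[rotated])
  hence "(\<lambda>n::nat. exp (- a * n) * real n powr p) summable_on UNIV"
    by (intro norm_summable_imp_summable_on) simp
  thus ?thesis by (rule summable_on_subset_banach) auto
qed

text \<open>As n_j <= n_r, the decay of t^{n_r} can be shared equally among the r coordinates. The
  series is then dominated by a product of one-variable series over all positive tuples, each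
  decaying like e^{-(a - \<epsilon>) n} up to a power.\<close>

lemma summable_on_mono_tuples:
  fixes t \<epsilon> :: real and p :: "nat \<Rightarrow> real"
  assumes r: "r \<ge> 1" and t: "0 < t" "t < 1" and \<epsilon>: "r * \<epsilon> < - ln t"
  shows "(\<lambda>n. t ^ n r * (\<Prod>j=1..r. exp (\<epsilon> * n j) * real (n j) powr p j)) summable_on mono_tuples r"
proof -
  \<comment> \<open>The share of decay per coordinate; the hypothesis on \<open>\<epsilon>\<close>
    says exactly that \<open>a > \<epsilon>\<close>.\<close>
  define a where "a = - ln t / r"
  have a: "a - \<epsilon> > 0" using r \<epsilon> by (simp add: a_def field_simps)
  have "a > 0" using r t by (simp add: a_def field_simps)
  let ?g = "\<lambda>n. \<Prod>j=1..r. exp (- (a - \<epsilon>) * real (n j)) * real (n j) powr p j"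
  have "(\<lambda>n. norm (exp (- (a - \<epsilon>) * real n) * real n powr p j)) summable_on {0<..}" for j
    using summable_on_exp_times_powr[OF a] by (simp add: abs_mult)
  hence "Infinite_Set_Sum.abs_summable_on ?g ({1..r} \<rightarrow>\<^sub>E {0<..})"
    by (intro abs_summable_on_prod_PiE) (simp_all add: abs_summable_equivalent[symmetric])
  hence "(\<lambda>n. norm (?g n)) summable_on ({1..r} \<rightarrow>\<^sub>E {0<..})"
    by (simp only: abs_summable_equivalent)
  hence "(\<lambda>n. norm (?g n)) summable_on mono_tuples r"
    by (rule summable_on_subset_banach) (auto simp: mono_tuples_def)
  hence "(\<lambda>n. norm (t ^ n r * (\<Prod>j=1..r. exp (\<epsilon> * n j) * real (n j) powr p j))) summable_on mono_tuples r"
  proof (rule Infinite_Sum.abs_summable_on_comparison_test)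
    fix n assume n: "n \<in> mono_tuples r"
    have "t ^ n r = exp (real (n r) * ln t)" using t by (simp add: exp_of_nat_mult)
    also have "real (n r) * ln t = - a * (\<Sum>j=1..r. real (n r))"
      using r by (simp add: a_def)
    also have "exp \<dots> \<le> exp (- a * (\<Sum>j=1..r. real (n j)))"
    proof -
      have "(\<Sum>j=1..r. real (n j)) \<le> (\<Sum>j=1..r. real (n r))"
        using mono_tuples_le[OF n] by (intro sum_mono) auto
      thus ?thesis using \<open>a > 0\<close> by simp
    qed
    also have "\<dots> = (\<Prod>j=1..r. exp (- a * n j))"
      by (simp add: sum_distrib_left exp_sum)
    finally have "t ^ n r * (\<Prod>j=1..r. exp (\<epsilon> * n j) * real (n j) powr p j)
        \<le> (\<Prod>j=1..r. exp (- a * n j)) * (\<Prod>j=1..r. exp (\<epsilon> * n j) * real (n j) powr p j)"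
      by (intro mult_right_mono prod_nonneg) auto
    also have "\<dots> = ?g n"
      unfolding prod.distrib[symmetric] by (intro prod.cong) (auto simp: algebra_simps exp_diff exp_minus field_simps)
    finally show "norm (t ^ n r * (\<Prod>j=1..r. exp (\<epsilon> * n j) * real (n j) powr p j)) \<le> norm (?g n)"
      using t by (simp add: abs_mult prod_nonneg)
  qed
  thus ?thesis by (rule abs_summable_summable)
qed

lemma sum_previous:
  assumes "n \<in> mono_tuples r" "k \<le> r"
  shows "(\<Sum>j=1..k. n j - previous n j) = (if k = 0 then 0 else n k)"
  using assms(2)
proof (induction k)
  case (Suc k)
  have "previous n (Suc k) < n (Suc k)"
    using Suc assms by (intro mono_tuples_previous_less) auto
  with Suc show ?case by (auto simp: previous_def)
qed simp

text \<open>A product of absolutely convergent series is the sum over all positive tuples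
  \<open>d\<close>. Partial sums and consecutive differences are mutually inverse bijections between
  these and the strictly increasing tuples; positivity of d_j corresponds to strictness.\<close>

lemma infsum_prod_mono_tuples:
  fixes f :: "nat \<Rightarrow> nat \<Rightarrow> complex"
  assumes "\<And>j. j \<in> {1..r} \<Longrightarrow> (\<lambda>n. norm (f j n)) summable_on {0<..}"
  shows "(\<Prod>j=1..r. infsum (f j) {0<..}) =
    (\<Sum>\<^sub>\<infinity>n\<in>mono_tuples r. \<Prod>j=1..r. f j (n j - previous n j))"
proof -
  have "(\<Prod>j=1..r. infsum (f j) {0<..}) = (\<Sum>\<^sub>\<infinity>d\<in>{1..r} \<rightarrow>\<^sub>E {0<..}. \<Prod>j=1..r. f j (d j))"
    using assms by (intro infsum_prod_PiE_abs[symmetric]) auto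
  also have "\<dots> = (\<Sum>\<^sub>\<infinity>n\<in>mono_tuples r. \<Prod>j=1..r. f j (n j - previous n j))"
  proof (rule infsum_reindex_bij_witness[of _ "\<lambda>n. restrict (\<lambda>j. n j - previous n j) {1..r}"
        "\<lambda>d. restrict (\<lambda>k. \<Sum>j=1..k. d j) {1..r}"])
    fix d :: "nat \<Rightarrow> nat" assume d: "d \<in> {1..r} \<rightarrow>\<^sub>E {0<..}"
    let ?n = "restrict (\<lambda>k. \<Sum>j=1..k. d j) {1..r}"
    have diff: "?n j - previous ?n j = d j" if "j \<in> {1..r}" for j
    proof (cases "j = 1")
      case False
      define i where "i = j - 1"
      have "j = Suc i" "i > 0" using False that by (auto simp: i_def)
      thus ?thesis using that by (auto simp: previous_def)
    qed (use that in \<open>auto simp: previous_def\<close>)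
    show "restrict (\<lambda>j. ?n j - previous ?n j) {1..r} = d"
      using d diff by (auto simp: PiE_iff extensional_def)
    show "?n \<in> mono_tuples r"
      unfolding mono_tuples_def mem_Collect_eq
    proof (intro conjI strict_mono_onI)
      show "?n \<in> {1..r} \<rightarrow>\<^sub>E {0<..}"
        using d by (auto simp: PiE_iff Ball_def intro!: sum_pos2[of _ 1])
      fix i j assume ij: "i \<in> {1..r}" "j \<in> {1..r}" "i < j"
      have "(\<Sum>k=1..i. d k) < (\<Sum>k=1..j. d k)"
        using ij d by (intro sum_strict_mono2[of _ _ j]) (auto simp: PiE_iff)
      thus "?n i < ?n j" using ij by simp
    qed
    show "(\<Prod>j=1..r. f j (?n j - previous ?n j)) = (\<Prod>j=1..r. f j (d j))"
      using diff by (intro prod.cong) auto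
  next
    fix n assume n: "n \<in> mono_tuples r"
    let ?d = "restrict (\<lambda>j. n j - previous n j) {1..r}"
    show "?d \<in> {1..r} \<rightarrow>\<^sub>E {0<..}"
      using mono_tuples_previous_less[OF n] by auto
    have "(\<Sum>j=1..k. ?d j) = n k" if "k \<in> {1..r}" for k
    proof -
      have "(\<Sum>j=1..k. ?d j) = (\<Sum>j=1..k. n j - previous n j)"
        using that by (intro sum.cong) auto
      thus ?thesis using sum_previous[OF n, of k] that by simp
    qed
    thus "restrict (\<lambda>k. \<Sum>j=1..k. ?d j) {1..r} = n"
      using n by (auto simp: mono_tuples_def PiE_iff extensional_def)
  qed
  finally show ?thesis .
qed

lemma infsum_Suc_reindex: "infsum f {0<..} = (\<Sum>\<^sub>\<infinity>n. f (Suc n))"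
  and summable_on_Suc_reindex: "f summable_on {0<..} \<longleftrightarrow> (\<lambda>n. f (Suc n)) summable_on UNIV"
proof -
  have "bij_betw Suc UNIV {0<..}"
    by (auto simp: bij_betw_def image_iff gr0_conv_Suc)
  thus "infsum f {0<..} = (\<Sum>\<^sub>\<infinity>n. f (Suc n))" "f summable_on {0<..} \<longleftrightarrow> (\<lambda>n. f (Suc n)) summable_on UNIV"
    by (auto simp: infsum_reindex_bij_betw summable_on_reindex_bij_betw)
qed

lemma infsum_eq_if_sums:
  fixes f :: "nat \<Rightarrow> complex"
  assumes "f sums S" "summable (\<lambda>n. norm (f n))"
  shows "infsum f UNIV = S" "(\<lambda>n. norm (f n)) summable_on UNIV"
  using assms norm_summable_imp_has_sum[of f S]
  by (auto intro!: infsumI norm_summable_imp_summable_on)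

text \<open>With z = t e^{-X} and c = log t - X the factor equals z/(1-z) + c z/(1-z)^2, a geometric
  series plus its derivative. The hypothesis on Re X is equivalent to |z| < 1.\<close>

lemma des_factor_series:
  fixes X :: complex
  assumes t: "0 < t" and X: "Re X > ln t"
  defines "f \<equiv> (\<lambda>n. (of_real t * exp (- X)) ^ n * (1 + of_nat n * (of_real (ln t) - X)))"
  shows "(\<lambda>n. norm (f n)) summable_on {0<..}" "infsum f {0<..} = des_factor t X"
proof -
  define z where "z = of_real t * exp (- X)"
  have "norm z = exp (ln t - Re X)"
    using t by (simp add: z_def norm_mult exp_diff exp_minus divide_inverse norm_inverse norm_exp_eq_Re)
  hence z: "norm z < 1" using X by simp
  have z0: "z \<noteq> 0" "1 - z \<noteq> 0" using t z by (auto simp: z_def)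
  define c where "c = of_real (ln t) - X"
  have 1: "(\<lambda>n. z * z ^ n) sums (z * (1 / (1 - z)))"
    using z by (intro sums_mult geometric_sums)
  have 2: "(\<lambda>n. (z * c) * (of_nat (Suc n) * z ^ n)) sums (z * c * (1 / (1 - z)\<^sup>2))"
    using z by (intro sums_mult geometric_deriv_sums)
  have f: "f (Suc n) = z * z ^ n + (z * c) * (of_nat (Suc n) * z ^ n)" for n
    unfolding f_def z_def[symmetric] c_def[symmetric] by (simp add: algebra_simps)
  have S: "(\<lambda>n. f (Suc n)) sums (z * (1 / (1 - z)) + z * c * (1 / (1 - z)\<^sup>2))"
    unfolding f using 1 2 by (rule sums_add)
  have nz: "norm (norm z) < 1" using z by simp
  have "summable (\<lambda>n. norm z * norm z ^ n + norm (z * c) * (of_nat (Suc n) * norm z ^ n))"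
    using geometric_deriv_sums[OF nz] nz
    by (intro summable_add summable_mult summable_geometric) (auto simp: sums_iff)
  hence A: "summable (\<lambda>n. norm (f (Suc n)))"
  proof (rule summable_comparison_test')
    show "norm (norm (f (Suc n))) \<le> norm z * norm z ^ n + norm (z * c) * (of_nat (Suc n) * norm z ^ n)" for n
      unfolding f real_norm_def abs_norm_cancel by (rule order_trans[OF norm_triangle_ineq]) (simp add: norm_mult norm_power del: of_nat_Suc)
  qed
  have Y: "1 / of_real t * exp X = 1 / z"
    using t by (simp add: z_def exp_minus field_simps)
  have "des_factor t X = z * (1 / (1 - z)) + z * c * (1 / (1 - z)\<^sup>2)"
    unfolding des_factor_def Y c_def[symmetric] using z0 by (simp add: divide_simps power2_eq_square)
  thus "(\<lambda>n. norm (f n)) summable_on {0<..}" "infsum f {0<..} = des_factor t X"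
    using infsum_eq_if_sums[OF S A] by (simp_all add: infsum_Suc_reindex summable_on_Suc_reindex)
qed

text \<open>Abel summation: after the order of summation is exchanged, x_k collects the differences
  with j <= k, and these telescope to n_k. It separates the exponential of the j-th tail sums into
  one-variable factors.\<close>

lemma sum_diff_times_tail_sum:
  fixes x :: "nat \<Rightarrow> complex"
  assumes "n \<in> mono_tuples r"
  shows "(\<Sum>j=1..r. of_nat (n j - previous n j) * (\<Sum>k=j..r. x k)) = (\<Sum>k=1..r. of_nat (n k) * x k)"
proof -
  have "(\<Sum>j=1..r. of_nat (n j - previous n j) * (\<Sum>k=j..r. x k))
     = (\<Sum>j=1..r. \<Sum>k\<in>{k\<in>{1..r}. j \<le> k}. of_nat (n j - previous n j) * x k)"
    unfolding sum_distrib_left by (intro sum.cong refl) auto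
  also have "\<dots> = (\<Sum>k=1..r. \<Sum>j\<in>{j\<in>{1..r}. j \<le> k}. of_nat (n j - previous n j) * x k)"
    by (rule sum.swap_restrict) auto
  also have "\<dots> = (\<Sum>k=1..r. of_nat (n k) * x k)"
  proof (intro sum.cong refl)
    fix k assume k: "k \<in> {1..r}"
    have "{j\<in>{1..r}. j \<le> k} = {1..k}" using k by auto
    hence "(\<Sum>j\<in>{j\<in>{1..r}. j \<le> k}. of_nat (n j - previous n j) * x k) = of_nat (\<Sum>j=1..k. n j - previous n j) * x k"
      by (simp add: sum_distrib_right)
    thus "(\<Sum>j\<in>{j\<in>{1..r}. j \<le> k}. of_nat (n j - previous n j) * x k) = of_nat (n k) * x k"
      using sum_previous[OF assms, of k] k by (simp only:) simp
  qed
  finally show ?thesis .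
qed

lemma prod_des_factor_series:
  fixes x :: "nat \<Rightarrow> complex"
  assumes r: "r \<ge> 1" and t: "0 < t" and x: "\<And>j. j \<in> {1..r} \<Longrightarrow> Re (\<Sum>k=j..r. x k) > ln t"
  shows "(\<Prod>j=1..r. des_factor t (\<Sum>k=j..r. x k)) =
    (\<Sum>\<^sub>\<infinity>n\<in>mono_tuples r. of_real t ^ n r *
       (\<Prod>j=1..r. 1 + of_nat (n j - previous n j) * (of_real (ln t) - (\<Sum>k=j..r. x k))) *
       (\<Prod>j=1..r. exp (- of_nat (n j) * x j)))"
proof -
  let ?X = "\<lambda>j. \<Sum>k=j..r. x k"
  let ?f = "\<lambda>j n. (of_real t * exp (- ?X j)) ^ n * (1 + of_nat n * (of_real (ln t) - ?X j))"
  have "(\<Prod>j=1..r. des_factor t (?X j)) = (\<Prod>j=1..r. infsum (?f j) {0<..})"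
    using des_factor_series(2)[OF t x] by (intro prod.cong) auto
  also have "\<dots> = (\<Sum>\<^sub>\<infinity>n\<in>mono_tuples r. \<Prod>j=1..r. ?f j (n j - previous n j))"
    using des_factor_series(1)[OF t x] by (intro infsum_prod_mono_tuples) auto
  also have "\<dots> = (\<Sum>\<^sub>\<infinity>n\<in>mono_tuples r. of_real t ^ n r *
       (\<Prod>j=1..r. 1 + of_nat (n j - previous n j) * (of_real (ln t) - ?X j)) *
       (\<Prod>j=1..r. exp (- of_nat (n j) * x j)))"
  proof (intro infsum_cong)
    fix n assume n: "n \<in> mono_tuples r"
    have "(\<Prod>j=1..r. ?f j (n j - previous n j)) = of_real t ^ (\<Sum>j=1..r. n j - previous n j) *
       exp (- (\<Sum>j=1..r. of_nat (n j - previous n j) * ?X j)) *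
       (\<Prod>j=1..r. 1 + of_nat (n j - previous n j) * (of_real (ln t) - ?X j))"
    proof -
      have "exp (- (\<Sum>j=1..r. of_nat (n j - previous n j) * ?X j)) =
          (\<Prod>j=1..r. exp (of_nat (n j - previous n j) * (- ?X j)))"
        by (subst exp_sum[symmetric]) (simp_all add: sum_negf)
      also have "\<dots> = (\<Prod>j=1..r. exp (- ?X j) ^ (n j - previous n j))"
        by (simp only: exp_of_nat_mult)
      finally show ?thesis
        by (simp only: prod.distrib power_mult_distrib power_sum mult_ac)
    qed
    also have "exp (- (\<Sum>j=1..r. of_nat (n j - previous n j) * ?X j)) = (\<Prod>j=1..r. exp (- of_nat (n j) * x j))"
      unfolding sum_diff_times_tail_sum[OF n] by (simp add: exp_sum sum_negf[symmetric])
    also have "(\<Sum>j=1..r. n j - previous n j) = n r"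
      using sum_previous[OF n order_refl] r by simp
    finally show "(\<Prod>j=1..r. ?f j (n j - previous n j)) = of_real t ^ n r *
       (\<Prod>j=1..r. 1 + of_nat (n j - previous n j) * (of_real (ln t) - ?X j)) *
       (\<Prod>j=1..r. exp (- of_nat (n j) * x j))" by (simp add: mult_ac)
  qed
  finally show ?thesis .
qed

subsection \<open>Hankel's formula for the Gamma function\<close>

text \<open>The integrand in the variable \<open>w = log x\<close>, in which the branch cut disappears: the contour becomes
  the path from \<open>\<infinity>\<close> to \<open>log \<epsilon>\<close>, up to \<open>log \<epsilon> + 2\<pi>i\<close>, and back to \<open>\<infinity> + 2\<pi>i\<close>.\<close>

definition gamma_fun :: "complex \<Rightarrow> real \<Rightarrow> complex \<Rightarrow> complex" where
  "gamma_fun s N w = exp (s * w) * exp (- (of_real N * exp w))"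

definition gamma_ray :: "complex \<Rightarrow> real \<Rightarrow> real \<Rightarrow> complex" where
  "gamma_ray s N x = gamma_fun (s - 1) N (of_real (ln x))"

text \<open>Under x = e^w the form x^{s-1} dx becomes e^{sw} dw, hence the parameter
  \<open>s\<close> here against \<open>s - 1\<close> in \<open>gamma_ray\<close>. The factor i is
  the derivative of w along the vertical segment.\<close>

definition hankel_arc :: "complex \<Rightarrow> real \<Rightarrow> real \<Rightarrow> real \<Rightarrow> complex" where
  "hankel_arc s N \<epsilon> \<tau> = \<i> * gamma_fun s N (Complex (ln \<epsilon>) \<tau>)"

text \<open>The one-variable part of the integrand of \<open>hankel_integral\<close>, weighted by
  e^{-Nx}, with the Jacobian of the parametrisation included.\<close>

definition hankel_kernel :: "complex \<Rightarrow> real \<Rightarrow> real \<Rightarrow> real \<Rightarrow> complex" where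
  "hankel_kernel s N \<epsilon> \<tau> =
     gamma_fun (s - 1) N (hankel_log \<epsilon> \<tau>) * vector_derivative (hankel \<epsilon>) (at \<tau>)"

lemma gamma_fun_shift: "exp w * gamma_fun s N w = gamma_fun (s + 1) N w"
  unfolding gamma_fun_def mult.assoc[symmetric] exp_add[symmetric] by (simp add: algebra_simps)

lemma gamma_fun_has_field_derivative:
  "(gamma_fun s N has_field_derivative s * gamma_fun s N w - of_real N * gamma_fun (s + 1) N w) (at w within A)"
  unfolding gamma_fun_shift[symmetric] unfolding gamma_fun_def[abs_def]
  by (auto intro!: derivative_eq_intros simp: algebra_simps)

lemma gamma_fun_holomorphic [holomorphic_intros]: "gamma_fun s N holomorphic_on A"
  unfolding holomorphic_on_def field_differentiable_def using gamma_fun_has_field_derivative by blast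

text \<open>The monodromy of x^s around the origin; e^{-N e^w} is periodic and contributes nothing.
  This is the source of the factor e^{2 pi i s} - 1.\<close>

lemma gamma_fun_period:
  "gamma_fun s N (w + 2 * of_real pi * \<i>) = exp (2 * of_real pi * \<i> * s) * gamma_fun s N w"
  by (simp add: gamma_fun_def distrib_left exp_add mult_ac)

lemma norm_gamma_fun:
  "norm (gamma_fun s N w) = exp (Re s * Re w - Im s * Im w) * exp (- (N * Re (exp w)))"
  by (simp add: gamma_fun_def norm_mult)

lemma gamma_fun_continuous [continuous_intros]:
  "continuous_on A f \<Longrightarrow> continuous_on A (\<lambda>x. gamma_fun s N (f x))"
  unfolding gamma_fun_def by (intro continuous_intros)

lemma gamma_fun_measurable [measurable]: "gamma_fun s N \<in> borel_measurable borel"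
  by (intro borel_measurable_continuous_onI continuous_intros)

lemma gamma_ray_measurable [measurable]: "gamma_ray s N \<in> borel_measurable borel"
  unfolding gamma_ray_def[abs_def] by measurable

lemma norm_gamma_ray: "x > 0 \<Longrightarrow> norm (gamma_ray s N x) = exp ((Re s - 1) * ln x) * exp (- (N * x))"
  by (simp add: gamma_ray_def norm_gamma_fun exp_of_real)

lemma Complex_ln: "Complex (ln \<epsilon>) \<tau> = of_real (ln \<epsilon>) + \<i> * of_real \<tau>"
  by (simp add: complex_eq_iff)

lemma gamma_ray_scale:
  "N > 0 \<Longrightarrow> x > 0 \<Longrightarrow> gamma_ray s 1 (N * x) = exp ((s - 1) * of_real (ln N)) * gamma_ray s N x"
  by (simp add: gamma_ray_def gamma_fun_def ln_mult exp_add distrib_left exp_of_real)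

text \<open>Euler's integral after the substitution x -> N x, which produces the power
  N^{-s}.\<close>

lemma has_bochner_integral_gamma_ray:
  assumes s: "Re s > 0" and N: "N > 0"
  shows "has_bochner_integral lborel (\<lambda>x. indicator {0<..} x *\<^sub>R gamma_ray s N x) (Gamma s * exp (- s * of_real (ln N)))"
proof -
  have eq: "of_real x powr (s - 1) / of_real (exp x) = gamma_ray s 1 x" if "x \<in> {0<..}" for x :: real
    using that by (simp add: gamma_ray_def gamma_fun_def powr_def Ln_of_real exp_minus divide_inverse exp_of_real)
  have "gamma_ray s 1 absolutely_integrable_on {0<..}"
    using absolutely_integrable_Gamma_integral'[OF s] eq set_integrable_cong[OF refl refl, of "{0<..}"]
    by (metis (no_types, lifting))
  \<comment> \<open>Passes from Lebesgue measure, in which Euler's integral is stated, to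
    \<open>lborel\<close>, in which the affine substitution is carried out.\<close>
  hence int: "set_integrable lborel {0<..} (gamma_ray s 1)"
    unfolding set_integrable_def by (subst (asm) integrable_completion) auto
  have "(gamma_ray s 1 has_integral Gamma s) {0<..}"
    using Gamma_integral_complex'[OF s] eq by (rule has_integral_eq[rotated])
  hence "has_bochner_integral lborel (\<lambda>x. indicator {0<..} x *\<^sub>R gamma_ray s 1 x) (Gamma s)"
    using set_borel_integral_eq_integral(2)[OF int] int
    by (simp add: has_bochner_integral_iff set_integrable_def set_lebesgue_integral_def integral_unique)
  hence "has_bochner_integral lborel (\<lambda>x. indicator {0<..} (0 + N * x) *\<^sub>R gamma_ray s 1 (0 + N * x)) (Gamma s /\<^sub>R \<bar>N\<bar>)"
    using N by (subst (asm) lborel_has_bochner_integral_real_affine_iff[of N _ _ 0]) auto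
  hence "has_bochner_integral lborel (\<lambda>x. exp (- (s - 1) * of_real (ln N)) * (indicator {0<..} (0 + N * x) *\<^sub>R gamma_ray s 1 (0 + N * x)))
      (exp (- (s - 1) * of_real (ln N)) * (Gamma s /\<^sub>R \<bar>N\<bar>))"
    by (rule has_bochner_integral_mult_right[rotated])
  moreover have "exp (- (s - 1) * of_real (ln N)) * (indicator {0<..} (0 + N * x) *\<^sub>R gamma_ray s 1 (0 + N * x))
     = indicator {0<..} x *\<^sub>R gamma_ray s N x" for x
  proof (cases "x > 0")
    case True
    have "exp (- (s - 1) * of_real (ln N)) * exp ((s - 1) * of_real (ln N)) = 1"
      unfolding exp_add[symmetric] by (simp add: algebra_simps)
    thus ?thesis using N True gamma_ray_scale[OF N True, of s]
      by (simp add: mult.assoc[symmetric])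
  next
    case False
    hence "\<not> (0 < N * x)" using N by (simp add: zero_less_mult_iff)
    thus ?thesis using False by simp
  qed
  moreover have "exp (- (s - 1) * of_real (ln N)) * (Gamma s /\<^sub>R \<bar>N\<bar>) = Gamma s * exp (- s * of_real (ln N))"
  proof -
    have "exp (- (s - 1) * of_real (ln N)) = exp (- s * of_real (ln N)) * of_real N"
      using N by (simp add: algebra_simps exp_diff exp_add exp_minus exp_of_real field_simps)
    thus ?thesis using N by (simp add: scaleR_conv_of_real)
  qed
  ultimately show ?thesis by simp
qed

text \<open>Away from the origin every complex \<open>s\<close> is admissible: for x > \<epsilon>
  the modulus of x^{s-1} is at most \<epsilon>^{-n} times that of x^{s+n-1}, and Euler's integral
  converges once Re s + n > 0.\<close>

lemma set_integrable_gamma_ray: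
  assumes N: "N > 0" and \<epsilon>: "\<epsilon> > 0"
  shows "set_integrable lborel {\<epsilon><..} (gamma_ray s N)"
proof -
  obtain n :: nat where n: "real n > - Re s" using reals_Archimedean2 by blast
  have "set_integrable lborel {0<..} (gamma_ray (s + of_nat n) N)"
    using has_bochner_integral_gamma_ray[of "s + of_nat n" N] n N
    by (simp add: set_integrable_def has_bochner_integral_iff)
  hence "set_integrable lborel {\<epsilon><..} (gamma_ray (s + of_nat n) N)"
    by (rule set_integrable_subset) (use \<epsilon> in auto)
  hence "set_integrable lborel {\<epsilon><..} (\<lambda>x. of_real (exp (- n * ln \<epsilon>)) * gamma_ray (s + of_nat n) N x)"
    by simp
  thus ?thesis
  proof (rule set_integrable_bound)
    show "set_borel_measurable lborel {\<epsilon><..} (gamma_ray s N)"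
      unfolding set_borel_measurable_def by measurable
    have "norm (gamma_ray s N x) \<le> norm (of_real (exp (- n * ln \<epsilon>)) * gamma_ray (s + of_nat n) N x)" if x: "x > \<epsilon>" for x
    proof -
      have "n * ln \<epsilon> \<le> n * ln x" using x \<epsilon> by (intro mult_left_mono) auto
      hence "exp ((Re s - 1) * ln x) \<le> exp (- n * ln \<epsilon>) * exp ((Re s + n - 1) * ln x)"
        unfolding exp_add[symmetric] exp_le_cancel_iff by (simp add: algebra_simps)
      hence "exp ((Re s - 1) * ln x) * exp (- (N * x)) \<le> exp (- n * ln \<epsilon>) * exp ((Re s + n - 1) * ln x) * exp (- (N * x))"
        by (rule mult_right_mono) simp
      thus ?thesis using x \<epsilon> by (simp add: norm_mult norm_gamma_ray mult.assoc)
    qed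
    thus "AE x in lborel. x \<in> {\<epsilon><..} \<longrightarrow>
        norm (gamma_ray s N x) \<le> norm (of_real (exp (- n * ln \<epsilon>)) * gamma_ray (s + of_nat n) N x)"
      by simp
  qed
qed

lemma set_integrable_hankel_arc: "set_integrable lborel {0..2 * pi} (hankel_arc s N \<epsilon>)"
  unfolding hankel_arc_def[abs_def] Complex_ln
  by (intro borel_integrable_atLeastAtMost' continuous_intros)

lemma gamma_fun_ln_has_vector_derivative:
  assumes "(P has_field_derivative P') (at (of_real (ln x)))" "x > 0"
  shows "((\<lambda>x. P (of_real (ln x))) has_vector_derivative P' / of_real x) (at x)"
proof -
  have "((\<lambda>x. of_real (ln x)) has_vector_derivative of_real (inverse x)) (at x)"
    using assms(2) by (intro has_vector_derivative_of_real has_real_derivative_iff_has_vector_derivative[THEN iffD1]) (auto intro!: derivative_eq_intros simp: inverse_eq_divide)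
  from field_vector_diff_chain_at[OF this assms(1)] show ?thesis
    by (simp add: o_def field_simps)
qed

lemma gamma_fun_divide: "x > 0 \<Longrightarrow> gamma_fun s N (of_real (ln x)) / of_real x = gamma_ray s N x"
  using gamma_fun_shift[of "of_real (ln x)" "s - 1" N]
  by (simp add: gamma_ray_def exp_of_real field_simps)

text \<open>In the variable w the circle is a vertical segment of length 2 pi, so the integral of a
  derivative is the increment of the primitive over that segment. It is applied both to
  \<open>gamma_fun\<close> itself as primitive and to a primitive of
  \<open>gamma_fun\<close>.\<close>

lemma integral_hankel_arc_FTC:
  assumes P: "\<And>w. (P has_field_derivative P' w) (at w)" and P': "continuous_on UNIV P'"
  shows "(LINT \<tau>:{0..2 * pi}|lborel. \<i> * P' (Complex (ln \<epsilon>) \<tau>)) =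
    P (of_real (ln \<epsilon>) + 2 * of_real pi * \<i>) - P (of_real (ln \<epsilon>))"
proof -
  have "(LINT \<tau>:{0..2 * pi}|lborel. \<i> * P' (Complex (ln \<epsilon>) \<tau>)) =
      P (Complex (ln \<epsilon>) (2 * pi)) - P (Complex (ln \<epsilon>) 0)"
    unfolding set_lebesgue_integral_def
  proof (rule integral_FTC_atLeastAtMost)
    fix \<tau> :: real
    have "((\<lambda>\<tau>. Complex (ln \<epsilon>) \<tau>) has_vector_derivative \<i>) (at \<tau> within {0..2 * pi})"
      unfolding Complex_ln by (auto intro!: derivative_eq_intros)
    moreover have "(P has_field_derivative P' (Complex (ln \<epsilon>) \<tau>))
         (at (Complex (ln \<epsilon>) \<tau>) within (\<lambda>\<tau>. Complex (ln \<epsilon>) \<tau>) ` {0..2 * pi})"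
      using P by (rule has_field_derivative_at_within)
    ultimately show "((\<lambda>\<tau>. P (Complex (ln \<epsilon>) \<tau>)) has_vector_derivative \<i> * P' (Complex (ln \<epsilon>) \<tau>))
         (at \<tau> within {0..2 * pi})"
      by (rule field_vector_diff_chain_within[unfolded o_def])
    show "continuous_on {0..2 * pi} (\<lambda>\<tau>. \<i> * P' (Complex (ln \<epsilon>) \<tau>))"
      unfolding Complex_ln by (intro continuous_intros continuous_on_compose2[OF P']) auto
  qed simp
  thus ?thesis unfolding Complex_ln by (simp add: mult_ac)
qed

text \<open>The top ray is run inwards and contributes -1 times the ray integral; the bottom ray is
  run outwards and carries the monodromy e^{2 pi i s}.\<close>

definition hankel_value :: "complex \<Rightarrow> real \<Rightarrow> real \<Rightarrow> complex" where
  "hankel_value s N \<epsilon> = (exp (2 * of_real pi * \<i> * s) - 1) * (LINT x:{\<epsilon><..}|lborel. gamma_ray s N x) +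
     (LINT \<tau>:{0..2 * pi}|lborel. hankel_arc s N \<epsilon> \<tau>)"

text \<open>Integration by parts: the total derivative of x^s e^{-Nx} is integrated over the
  contour. The boundary term at \<epsilon> occurs with factor e^{2 pi i s} - 1 from the arc and with
  the opposite factor from the two rays, and exponential decay removes the one at infinity.\<close>

lemma hankel_value_recurrence:
  assumes N: "N > 0" and \<epsilon>: "\<epsilon> > 0"
  shows "s * hankel_value s N \<epsilon> = of_real N * hankel_value (s + 1) N \<epsilon>"
proof -
  let ?e = "exp (2 * of_real pi * \<i> * s)"
  let ?P' = "\<lambda>w. s * gamma_fun s N w - of_real N * gamma_fun (s + 1) N w"
  let ?L = "of_real (ln \<epsilon>) :: complex"
  have e: "exp (2 * of_real pi * \<i> * (s + 1)) = ?e"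
    by (simp add: distrib_left exp_add)
  have "(LINT \<tau>:{0..2 * pi}|lborel. \<i> * ?P' (Complex (ln \<epsilon>) \<tau>)) = gamma_fun s N (?L + 2 * of_real pi * \<i>) - gamma_fun s N ?L"
    by (rule integral_hankel_arc_FTC) (auto intro!: gamma_fun_has_field_derivative continuous_intros)
  also have "\<dots> = (?e - 1) * gamma_fun s N ?L"
    unfolding gamma_fun_period by (simp add: algebra_simps)
  also have "(\<lambda>\<tau>. \<i> * ?P' (Complex (ln \<epsilon>) \<tau>)) = (\<lambda>\<tau>. s * hankel_arc s N \<epsilon> \<tau> - of_real N * hankel_arc (s + 1) N \<epsilon> \<tau>)"
    by (auto simp: hankel_arc_def algebra_simps)
  finally have arc: "s * (LINT \<tau>:{0..2 * pi}|lborel. hankel_arc s N \<epsilon> \<tau>) -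
      of_real N * (LINT \<tau>:{0..2 * pi}|lborel. hankel_arc (s + 1) N \<epsilon> \<tau>) = (?e - 1) * gamma_fun s N ?L"
    by (simp add: set_integral_diff set_integrable_hankel_arc)
  let ?F = "\<lambda>x. gamma_fun s N (of_real (ln x))"
  let ?f = "\<lambda>x. s * gamma_ray s N x - of_real N * gamma_ray (s + 1) N x"
  have int: "set_integrable lborel {\<epsilon><..} ?f"
    by (intro set_integral_diff(1) set_integrable_mult_right set_integrable_gamma_ray N \<epsilon>)
  have F: "(?F has_vector_derivative ?f x) (at x)" if "x > 0" for x
    using gamma_fun_ln_has_vector_derivative[OF gamma_fun_has_field_derivative that, of s N]
      gamma_fun_divide[OF that, of s N] gamma_fun_divide[OF that, of "s + 1" N]
    by (simp only: diff_divide_distrib times_divide_eq_right[symmetric])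
  have "(LBINT x=ereal \<epsilon>..\<infinity>. ?f x) = 0 - ?F \<epsilon>"
  proof (rule interval_integral_FTC_integrable)
    show "(?F has_vector_derivative ?f x) (at x)" if "ereal \<epsilon> < ereal x" for x
      using that \<epsilon> by (intro F) simp
    show "isCont ?f x" if "ereal \<epsilon> < ereal x" for x
    proof -
      have "continuous_on {0<..} ?f"
        unfolding gamma_ray_def by (intro continuous_intros) auto
      thus ?thesis using that \<epsilon> by (auto simp: continuous_on_eq_continuous_at)
    qed
    have "einterval (ereal \<epsilon>) \<infinity> = {\<epsilon><..}" by auto
    thus "set_integrable lborel (einterval (ereal \<epsilon>) \<infinity>) ?f" using int by simp
    have "isCont ?F \<epsilon>" using F[OF \<epsilon>] by (rule has_vector_derivative_continuous)
    hence "(?F \<longlongrightarrow> ?F \<epsilon>) (at_right \<epsilon>)"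
      unfolding isCont_def by (rule tendsto_mono[OF at_le, rotated]) simp
    thus "((?F \<circ> real_of_ereal) \<longlongrightarrow> ?F \<epsilon>) (at_right (ereal \<epsilon>))"
      by (simp only: ereal_tendsto_simps1)
    have "((\<lambda>x. exp (Re s * ln x) * exp (- (N * x))) \<longlongrightarrow> 0) at_top"
      using N by real_asymp
    moreover have "eventually (\<lambda>x. exp (Re s * ln x) * exp (- (N * x)) = norm (?F x)) at_top"
      using eventually_gt_at_top[of 0] by eventually_elim (simp add: norm_gamma_fun exp_of_real)
    ultimately have "((\<lambda>x. norm (?F x)) \<longlongrightarrow> 0) at_top"
      by (rule Lim_transform_eventually)
    hence "(?F \<longlongrightarrow> 0) at_top" by (rule tendsto_norm_zero_cancel)
    thus "((?F \<circ> real_of_ereal) \<longlongrightarrow> 0) (at_left \<infinity>)"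
      by (simp only: ereal_tendsto_simps1)
  qed simp
  hence "(LINT x:{\<epsilon><..}|lborel. ?f x) = - gamma_fun s N ?L"
    by (simp add: interval_integral_to_infinity_eq)
  hence ray: "s * (LINT x:{\<epsilon><..}|lborel. gamma_ray s N x) -
      of_real N * (LINT x:{\<epsilon><..}|lborel. gamma_ray (s + 1) N x) = - gamma_fun s N ?L"
    by (subst (asm) set_integral_diff) (simp_all add: set_integrable_gamma_ray N \<epsilon>)
  have "s * hankel_value s N \<epsilon> - of_real N * hankel_value (s + 1) N \<epsilon> =
      (?e - 1) * (s * (LINT x:{\<epsilon><..}|lborel. gamma_ray s N x) -
        of_real N * (LINT x:{\<epsilon><..}|lborel. gamma_ray (s + 1) N x)) +
      (s * (LINT \<tau>:{0..2 * pi}|lborel. hankel_arc s N \<epsilon> \<tau>) -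
        of_real N * (LINT \<tau>:{0..2 * pi}|lborel. hankel_arc (s + 1) N \<epsilon> \<tau>))"
    unfolding hankel_value_def e by (simp add: algebra_simps)
  also have "\<dots> = 0" unfolding ray arc by simp
  finally show ?thesis by simp
qed

text \<open>Length 2 pi times the maximum of the integrand in w. The factor e^N comes from Re (e^w)
  >= -1, which holds since |e^w| = \<epsilon> <= 1. As Re s > 0, the power of \<epsilon> forces the
  arc integral to 0.\<close>

lemma norm_integral_hankel_arc_le:
  assumes P: "\<And>w. (P has_field_derivative gamma_fun s N w) (at w)"
    and s: "Re s > 0" and N: "N > 0" and \<epsilon>: "0 < \<epsilon>"  "\<epsilon> \<le> 1"
  shows "norm (LINT \<tau>:{0..2 * pi}|lborel. hankel_arc s N \<epsilon> \<tau>) \<le> exp (Re s * ln \<epsilon>) * (exp (\<bar>Im s\<bar> * (2 * pi)) * exp N * (2 * pi))"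
proof -
  let ?a = "of_real (ln \<epsilon>) :: complex"
  let ?B = "exp (Re s * ln \<epsilon>) * (exp (\<bar>Im s\<bar> * (2 * pi)) * exp N)"
  have arc: "(LINT \<tau>:{0..2 * pi}|lborel. hankel_arc s N \<epsilon> \<tau>) = P (?a + 2 * of_real pi * \<i>) - P ?a"
    unfolding hankel_arc_def by (rule integral_hankel_arc_FTC) (auto intro!: P continuous_intros)
  have "norm (P (?a + 2 * of_real pi * \<i>) - P ?a) \<le> ?B * norm (?a + 2 * of_real pi * \<i> - ?a)"
  proof (rule field_differentiable_bound[of "closed_segment ?a (?a + 2 * of_real pi * \<i>)"])
    fix w assume "w \<in> closed_segment ?a (?a + 2 * of_real pi * \<i>)"
    then obtain u where u: "0 \<le> u" "u \<le> 1" "w = (1 - u) *\<^sub>R ?a + u *\<^sub>R (?a + 2 * of_real pi * \<i>)"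
      by (auto simp: closed_segment_def)
    have w: "Re w = ln \<epsilon>" "Im w = u * (2 * pi)"
      using u by (simp_all add: algebra_simps)
    have "- (Im s * Im w) \<le> \<bar>Im s\<bar> * \<bar>Im w\<bar>" using abs_ge_minus_self[of "Im s * Im w"] by (simp only: abs_mult)
    also have "\<dots> \<le> \<bar>Im s\<bar> * (2 * pi)"
      using u unfolding w by (intro mult_left_mono) (auto simp: abs_mult mult_le_cancel_right1)
    finally have 1: "Re s * Re w - Im s * Im w \<le> Re s * ln \<epsilon> + \<bar>Im s\<bar> * (2 * pi)" unfolding w by simp
    have "norm (exp w) \<le> 1" using \<epsilon> w by simp
    hence "- Re (exp w) \<le> 1" using abs_Re_le_cmod[of "exp w"] by linarith
    hence 2: "- (N * Re (exp w)) \<le> N" using N mult_left_mono[of "- Re (exp w)" 1 N] by simp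
    have "norm (gamma_fun s N w) \<le> exp (Re s * ln \<epsilon> + \<bar>Im s\<bar> * (2 * pi)) * exp N"
      unfolding norm_gamma_fun using 1 2 by (intro mult_mono) auto
    thus "norm (gamma_fun s N w) \<le> ?B" by (simp add: exp_add mult_ac)
  qed (auto intro: has_field_derivative_at_within P)
  thus ?thesis unfolding arc by (simp add: norm_mult mult_ac)
qed

text \<open>A primitive \<open>P\<close> of \<open>gamma_fun s N\<close> satisfies \<open>P (w + 2\<pi>i) = e\<^bsup>2\<pi>is\<^esup> P w + c\<close>. Hence the contour
  integral does not depend on \<open>\<epsilon>\<close>, and letting \<open>\<epsilon>\<close> tend to \<open>0\<close> leaves only the two rays.\<close>

lemma hankel_value_eq_pos:
  assumes s: "Re s > 0" and N: "N > 0" and \<epsilon>: "\<epsilon> > 0"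
  shows "hankel_value s N \<epsilon> = (exp (2 * of_real pi * \<i> * s) - 1) * Gamma s * exp (- s * of_real (ln N))"
proof -
  let ?e = "exp (2 * of_real pi * \<i> * s)"
  obtain P where P: "\<And>w. (P has_field_derivative gamma_fun s N w) (at w)"
    using holomorphic_convex_primitive[of UNIV "{}" "gamma_fun s N"]
      holomorphic_on_imp_continuous_on[OF gamma_fun_holomorphic]
      holomorphic_on_imp_differentiable_at[OF gamma_fun_holomorphic open_UNIV] by auto
  have "((\<lambda>w. P (w + 2 * of_real pi * \<i>) - ?e * P w) has_field_derivative 0) (at w)" for w
    by (rule derivative_eq_intros DERIV_chain2[OF P] P refl)+ (simp add: gamma_fun_period)
  then obtain c where c: "\<And>w. P (w + 2 * of_real pi * \<i>) - ?e * P w = c"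
    using has_field_derivative_zero_constant[of UNIV "\<lambda>w. P (w + 2 * of_real pi * \<i>) - ?e * P w"] by auto
  have arc: "(LINT \<tau>:{0..2 * pi}|lborel. hankel_arc s N \<delta> \<tau>) = c + (?e - 1) * P (of_real (ln \<delta>))" for \<delta>
  proof -
    have "(LINT \<tau>:{0..2 * pi}|lborel. hankel_arc s N \<delta> \<tau>) =
        P (of_real (ln \<delta>) + 2 * of_real pi * \<i>) - P (of_real (ln \<delta>))"
      unfolding hankel_arc_def by (rule integral_hankel_arc_FTC) (auto intro!: P continuous_intros)
    thus ?thesis using c[of "of_real (ln \<delta>)"] by (simp add: algebra_simps)
  qed
  have ray: "(LINT x:{\<delta><..}|lborel. gamma_ray s N x) =
      P (of_real (ln \<epsilon>)) - P (of_real (ln \<delta>)) + (LINT x:{\<epsilon><..}|lborel. gamma_ray s N x)"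
    if \<delta>: "0 < \<delta>" "\<delta> < \<epsilon>" for \<delta>
  proof -
    have "(LINT x:{\<delta>..\<epsilon>}|lborel. gamma_ray s N x) = P (of_real (ln \<epsilon>)) - P (of_real (ln \<delta>))"
      unfolding set_lebesgue_integral_def
    proof (rule integral_FTC_atLeastAtMost)
      show "((\<lambda>x. P (of_real (ln x))) has_vector_derivative gamma_ray s N x) (at x within {\<delta>..\<epsilon>})"
        if "\<delta> \<le> x" for x
      proof -
        have x: "x > 0" using that \<delta> by simp
        show ?thesis using gamma_fun_ln_has_vector_derivative[OF P x] gamma_fun_divide[OF x]
          by (auto intro: has_vector_derivative_at_within)
      qed
      show "continuous_on {\<delta>..\<epsilon>} (gamma_ray s N)"
        unfolding gamma_ray_def[abs_def] using \<delta> by (intro continuous_intros) auto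
    qed (use \<delta> in simp)
    moreover have "(LINT x:{\<delta>..\<epsilon>}|lborel. gamma_ray s N x) = (LINT x:{\<delta><..\<epsilon>}|lborel. gamma_ray s N x)"
      by (rule set_integral_discrete_difference[of "{\<delta>}"]) auto
    moreover have "{\<delta><..} = {\<delta><..\<epsilon>} \<union> {\<epsilon><..}" using \<delta> by auto
    hence "(LINT x:{\<delta><..}|lborel. gamma_ray s N x) = (LINT x:{\<delta><..\<epsilon>} \<union> {\<epsilon><..}|lborel. gamma_ray s N x)"
      by simp
    moreover have "(LINT x:{\<delta><..\<epsilon>} \<union> {\<epsilon><..}|lborel. gamma_ray s N x) =
        (LINT x:{\<delta><..\<epsilon>}|lborel. gamma_ray s N x) + (LINT x:{\<epsilon><..}|lborel. gamma_ray s N x)"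
      by (intro set_integral_Un set_integrable_gamma_ray N \<epsilon>
            set_integrable_subset[OF set_integrable_gamma_ray[OF N \<delta>(1)]]) auto
    ultimately show ?thesis by simp
  qed
  have const: "hankel_value s N \<delta> = hankel_value s N \<epsilon>" if \<delta>: "0 < \<delta>" "\<delta> < \<epsilon>" for \<delta>
    unfolding hankel_value_def arc ray[OF \<delta>] by (simp add: algebra_simps)
  \<comment> \<open>A decreasing null sequence of radii. The minimum keeps them at most 1, as the
    arc estimate demands, and below \<open>\<epsilon>\<close>, as the comparison of the two contours
    demands.\<close>
  define \<delta> where "\<delta> = (\<lambda>n::nat. min 1 (\<epsilon> / 2) / real (Suc n))"
  have \<delta>_pos: "\<delta> n > 0" for n using \<epsilon> by (simp add: \<delta>_def)
  have "\<delta> n \<le> min 1 (\<epsilon> / 2) / 1" for n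
    unfolding \<delta>_def using \<epsilon> by (intro divide_left_mono) auto
  hence \<delta>_min: "\<delta> n \<le> 1" "\<delta> n \<le> \<epsilon> / 2" for n by simp_all
  have \<delta>_le: "\<delta> n \<le> 1" "\<delta> n < \<epsilon>" for n using \<epsilon> \<delta>_min[of n] by linarith+
  have \<delta>_lim: "\<delta> \<longlonglongrightarrow> 0"
    unfolding \<delta>_def by (intro tendsto_divide_0[OF tendsto_const] filterlim_at_top_imp_at_infinity
        filterlim_compose[OF filterlim_real_sequentially filterlim_Suc])
  have "decseq \<delta>"
    unfolding \<delta>_def decseq_def using \<epsilon> by (auto intro!: divide_left_mono)
  have un: "(\<Union>n. {\<delta> n<..}) = {0<..}"
  proof (intro equalityI subsetI)
    fix x assume "x \<in> (\<Union>n. {\<delta> n<..})"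
    then obtain n where "\<delta> n < x" by auto
    thus "x \<in> {0<..}" using \<delta>_pos[of n] by simp
  next
    fix x :: real assume "x \<in> {0<..}"
    hence "x > 0" by simp
    with \<delta>_lim have "eventually (\<lambda>n. \<delta> n < x) sequentially" by (rule order_tendstoD(2))
    then obtain n where "\<delta> n < x" by (auto simp: eventually_sequentially)
    thus "x \<in> (\<Union>n. {\<delta> n<..})" by auto
  qed
  have hb: "set_integrable lborel {0<..} (gamma_ray s N)"
      "(LINT x:{0<..}|lborel. gamma_ray s N x) = Gamma s * exp (- s * of_real (ln N))"
    using has_bochner_integral_gamma_ray[OF s N]
    by (simp_all add: set_integrable_def set_lebesgue_integral_def has_bochner_integral_iff)
  have "(\<lambda>n. LINT x:{\<delta> n<..}|lborel. gamma_ray s N x) \<longlonglongrightarrow> (LINT x:(\<Union>n. {\<delta> n<..})|lborel. gamma_ray s N x)"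
    using \<open>decseq \<delta>\<close> hb(1) by (intro set_integral_cont_up) (auto simp: un incseq_def decseq_def intro: le_less_trans)
  hence lim_ray: "(\<lambda>n. LINT x:{\<delta> n<..}|lborel. gamma_ray s N x) \<longlonglongrightarrow> Gamma s * exp (- s * of_real (ln N))"
    unfolding un hb(2) .
  have "filterlim \<delta> (at_right 0) sequentially"
    using \<delta>_lim \<delta>_pos less_imp_neq[OF \<delta>_pos] by (auto simp: filterlim_at)
  moreover have "((\<lambda>x. exp (Re s * ln x)) \<longlongrightarrow> 0) (at_right 0)"
    using s by real_asymp
  ultimately have "(\<lambda>n. exp (Re s * ln (\<delta> n))) \<longlonglongrightarrow> 0"
    by (rule filterlim_compose[rotated])
  hence "(\<lambda>n. exp (Re s * ln (\<delta> n)) * (exp (\<bar>Im s\<bar> * (2 * pi)) * exp N * (2 * pi))) \<longlonglongrightarrow> 0"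
    by (rule tendsto_mult_left_zero)
  hence lim_arc: "(\<lambda>n. LINT \<tau>:{0..2 * pi}|lborel. hankel_arc s N (\<delta> n) \<tau>) \<longlonglongrightarrow> 0"
    by (rule Lim_null_comparison[rotated])
       (intro always_eventually allI norm_integral_hankel_arc_le[OF P s N \<delta>_pos \<delta>_le(1)])
  have "(\<lambda>n. hankel_value s N (\<delta> n)) \<longlonglongrightarrow> (?e - 1) * (Gamma s * exp (- s * of_real (ln N))) + 0"
    unfolding hankel_value_def by (intro tendsto_intros lim_ray lim_arc)
  moreover have "(\<lambda>n. hankel_value s N (\<delta> n)) = (\<lambda>n. hankel_value s N \<epsilon>)"
    using const[OF \<delta>_pos \<delta>_le(2)] by simp
  ultimately show ?thesis
    using LIMSEQ_unique[OF tendsto_const] by (fastforce simp: mult.assoc)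
qed

text \<open>The recurrence in \<open>s\<close> extends the formula from \<open>Re s > 0\<close> without analytic continuation.\<close>

lemma hankel_value_eq:
  assumes s: "s \<notin> \<int>" and N: "N > 0" and \<epsilon>: "\<epsilon> > 0"
  shows "hankel_value s N \<epsilon> = (exp (2 * of_real pi * \<i> * s) - 1) * Gamma s * exp (- s * of_real (ln N))"
proof -
  \<comment> \<open>The induction variable counts unit shifts sufficient to reach the half-plane Re
    s > 0; each backward step divides by \<open>s\<close>, which is nonzero because it is not an
    integer.\<close>
  have "hankel_value s N \<epsilon> = (exp (2 * of_real pi * \<i> * s) - 1) * Gamma s * exp (- s * of_real (ln N))"
    if "s \<notin> \<int>" "Re s + real n > 0" for n s
    using that
  proof (induction n arbitrary: s)
    case (Suc n)
    have "s + 1 \<notin> \<int>" using Suc.prems(1) Ints_diff[of "s + 1" 1] by auto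
    hence IH: "hankel_value (s + 1) N \<epsilon> = (exp (2 * of_real pi * \<i> * (s + 1)) - 1) * Gamma (s + 1) * exp (- (s + 1) * of_real (ln N))"
      using Suc.prems by (intro Suc.IH) auto
    have "s \<noteq> 0" using Suc.prems by auto
    have "s \<notin> \<int>\<^sub>\<le>\<^sub>0" using Suc.prems by (auto elim!: nonpos_Ints_cases)
    hence G: "Gamma (s + 1) = s * Gamma s" by (rule Gamma_plus1)
    have e: "exp (2 * of_real pi * \<i> * (s + 1)) = exp (2 * of_real pi * \<i> * s)"
      by (simp add: distrib_left exp_add)
    have NN: "of_real N * exp (- (s + 1) * of_real (ln N)) = exp (- s * of_real (ln N))"
      using N by (simp add: algebra_simps exp_diff exp_add exp_minus exp_of_real field_simps)
    have "s * hankel_value s N \<epsilon> = (exp (2 * of_real pi * \<i> * s) - 1) * (s * Gamma s) * (of_real N * exp (- (s + 1) * of_real (ln N)))"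
      unfolding hankel_value_recurrence[OF N \<epsilon>] IH G e by simp
    thus ?case unfolding NN using \<open>s \<noteq> 0\<close> by simp
  next
    case 0
    thus ?case using N \<epsilon> by (intro hankel_value_eq_pos) auto
  qed
  moreover obtain n :: nat where "real n > - Re s" using reals_Archimedean2 by blast
  hence "Re s + real n > 0" by simp
  ultimately show ?thesis using s by blast
qed

section \<open>The parametrised contour and its kernel\<close>

lemma vector_derivative_hankel:
  assumes \<epsilon>: "\<epsilon> > 0"
  shows "\<tau> < 0 \<Longrightarrow> vector_derivative (hankel \<epsilon>) (at \<tau>) = -1"
    and "0 < \<tau> \<Longrightarrow> \<tau> < 2 * pi \<Longrightarrow> vector_derivative (hankel \<epsilon>) (at \<tau>) = \<i> * exp (Complex (ln \<epsilon>) \<tau>)"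
    and "\<tau> > 2 * pi \<Longrightarrow> vector_derivative (hankel \<epsilon>) (at \<tau>) = 1"
proof -
  have *: "exp (Complex (ln x) 0) = of_real x" "exp (Complex (ln x) (2 * pi)) = of_real x" if "x > 0" for x
    using that by (simp_all add: Complex_ln exp_add exp_of_real mult_ac) 
  show "vector_derivative (hankel \<epsilon>) (at \<tau>) = -1" if "\<tau> < 0"
  proof (rule vector_derivative_at, rule has_vector_derivative_transform_within_open)
    show "((\<lambda>\<tau>. of_real (\<epsilon> - \<tau>)) has_vector_derivative - 1) (at \<tau>)"
      by (auto intro!: derivative_eq_intros)
    show "of_real (\<epsilon> - y) = hankel \<epsilon> y" if "y \<in> {..<0}" for y
      using that \<epsilon> by (simp add: hankel_def hankel_log_def *)
  qed (use that in auto)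
  show "vector_derivative (hankel \<epsilon>) (at \<tau>) = \<i> * exp (Complex (ln \<epsilon>) \<tau>)" if "0 < \<tau>" "\<tau> < 2 * pi"
  proof (rule vector_derivative_at, rule has_vector_derivative_transform_within_open)
    have "((\<lambda>\<tau>. Complex (ln \<epsilon>) \<tau>) has_vector_derivative \<i>) (at \<tau>)"
      unfolding Complex_ln by (auto intro!: derivative_eq_intros)
    from field_vector_diff_chain_at[OF this DERIV_exp]
    show "((\<lambda>\<tau>. exp (Complex (ln \<epsilon>) \<tau>)) has_vector_derivative \<i> * exp (Complex (ln \<epsilon>) \<tau>)) (at \<tau>)"
      by (simp add: o_def)
    show "exp (Complex (ln \<epsilon>) y) = hankel \<epsilon> y" if "y \<in> {0<..<2 * pi}" for y
      using that by (simp add: hankel_def hankel_log_def)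
  qed (use that in auto)
  show "vector_derivative (hankel \<epsilon>) (at \<tau>) = 1" if "\<tau> > 2 * pi"
  proof (rule vector_derivative_at, rule has_vector_derivative_transform_within_open)
    show "((\<lambda>\<tau>. of_real (\<epsilon> + \<tau> - 2 * pi)) has_vector_derivative 1) (at \<tau>)"
      by (auto intro!: derivative_eq_intros)
    show "of_real (\<epsilon> + y - 2 * pi) = hankel \<epsilon> y" if "y \<in> {2 * pi<..}" for y
    proof -
      have "\<epsilon> + y - 2 * pi > 0" "\<not> y < 0" using that \<epsilon> pi_gt_zero by (auto intro: less_trans simp del: pi_gt_zero) 
      thus ?thesis using that by (simp add: hankel_def hankel_log_def *)
    qed
  qed (use that in auto)
qed

text \<open>The indicators of the affine arguments select \<tau> < 0 and \<tau> > 2 pi. The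
  redundant-looking products with -1 and 1 put the arguments into the form t + c \<tau> of the
  affine substitution rule.\<close>

lemma hankel_kernel_decomposition:
  assumes \<epsilon>: "\<epsilon> > 0" and \<tau>: "\<tau> \<noteq> 0" "\<tau> \<noteq> 2 * pi"
  shows "hankel_kernel s N \<epsilon> \<tau> =
      - (indicator {\<epsilon><..} (\<epsilon> + (-1) * \<tau>) *\<^sub>R gamma_ray s N (\<epsilon> + (-1) * \<tau>)) +
      exp (2 * of_real pi * \<i> * s) * (indicator {\<epsilon><..} (\<epsilon> - 2 * pi + 1 * \<tau>) *\<^sub>R gamma_ray s N (\<epsilon> - 2 * pi + 1 * \<tau>)) +
      indicator {0..2 * pi} \<tau> *\<^sub>R hankel_arc s N \<epsilon> \<tau>"
proof -
  consider "\<tau> < 0" | "0 < \<tau>" "\<tau> < 2 * pi" | "\<tau> > 2 * pi" using \<tau> by linarith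
  thus ?thesis
  proof cases
    case 1
    have "\<not> \<tau> > 2 * pi" using 1 pi_gt_zero by linarith
    moreover have "hankel_log \<epsilon> \<tau> = of_real (ln (\<epsilon> - \<tau>))"
      using 1 by (simp add: hankel_log_def complex_eq_iff)
    ultimately show ?thesis using 1 \<epsilon>
      by (simp add: hankel_kernel_def vector_derivative_hankel(1) gamma_ray_def indicator_def)
  next
    case 2
    have "hankel_log \<epsilon> \<tau> = Complex (ln \<epsilon>) \<tau>"
      using 2 by (simp add: hankel_log_def)
    thus ?thesis using 2 \<epsilon> gamma_fun_shift[of "Complex (ln \<epsilon>) \<tau>" "s - 1" N]
      by (simp add: hankel_kernel_def vector_derivative_hankel(2) hankel_arc_def indicator_def mult_ac)
  next
    case 3
    have "\<not> \<tau> < 0" using 3 pi_gt_zero by linarith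
    moreover have "hankel_log \<epsilon> \<tau> = of_real (ln (\<epsilon> - 2 * pi + \<tau>)) + 2 * of_real pi * \<i>"
      using 3 \<open>\<not> \<tau> < 0\<close> by (simp add: hankel_log_def complex_eq_iff algebra_simps)
    moreover have "exp (2 * of_real pi * \<i> * (s - 1)) = exp (2 * of_real pi * \<i> * s)"
      by (simp add: right_diff_distrib exp_diff)
    ultimately show ?thesis using 3 \<epsilon>
      by (simp add: hankel_kernel_def vector_derivative_hankel(3) gamma_ray_def gamma_fun_period indicator_def)
  qed
qed

lemma has_bochner_integral_hankel_kernel:
  assumes \<epsilon>: "\<epsilon> > 0" and N: "N > 0"
  shows "has_bochner_integral lborel (hankel_kernel s N \<epsilon>) (hankel_value s N \<epsilon>)"
proof -
  define g where "g = (\<lambda>\<tau>. - (indicator {\<epsilon><..} (\<epsilon> + (-1) * \<tau>) *\<^sub>R gamma_ray s N (\<epsilon> + (-1) * \<tau>)) +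
      exp (2 * of_real pi * \<i> * s) * (indicator {\<epsilon><..} (\<epsilon> - 2 * pi + 1 * \<tau>) *\<^sub>R gamma_ray s N (\<epsilon> - 2 * pi + 1 * \<tau>)) +
      indicator {0..2 * pi} \<tau> *\<^sub>R hankel_arc s N \<epsilon> \<tau>)"
  let ?T = "LINT x:{\<epsilon><..}|lborel. gamma_ray s N x"
  have G: "has_bochner_integral lborel (\<lambda>x. indicator {\<epsilon><..} x *\<^sub>R gamma_ray s N x) ?T"
    using set_integrable_gamma_ray[OF N \<epsilon>, of s]
    by (simp add: set_integrable_def set_lebesgue_integral_def has_bochner_integral_iff)
  have "has_bochner_integral lborel (\<lambda>\<tau>. indicator {\<epsilon><..} (t + c * \<tau>) *\<^sub>R gamma_ray s N (t + c * \<tau>)) (?T /\<^sub>R \<bar>c\<bar>)"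
    if "c \<noteq> 0" for c t
    using G lborel_has_bochner_integral_real_affine_iff[OF that, of "\<lambda>x. indicator {\<epsilon><..} x *\<^sub>R gamma_ray s N x" ?T t]
    by blast
  from this[of "-1" \<epsilon>] this[of 1 "\<epsilon> - 2 * pi"]
  have "has_bochner_integral lborel g (- ?T + exp (2 * of_real pi * \<i> * s) * ?T +
      (LINT \<tau>:{0..2 * pi}|lborel. hankel_arc s N \<epsilon> \<tau>))"
    unfolding g_def using set_integrable_hankel_arc[of s N \<epsilon>]
    by (intro has_bochner_integral_add has_bochner_integral_minus has_bochner_integral_mult_right)
       (simp_all add: set_integrable_def set_lebesgue_integral_def has_bochner_integral_iff)
  hence g: "has_bochner_integral lborel g (hankel_value s N \<epsilon>)"
    by (simp add: hankel_value_def algebra_simps)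
  hence [measurable]: "g \<in> borel_measurable lborel" by (auto simp: has_bochner_integral_iff)
  \<comment> \<open>At the two corners the derivative is unspecified. Treating the kernel's values
    there as constants makes it visibly a measurable modification of \<open>g\<close> at two
    points.\<close>
  have eq: "hankel_kernel s N \<epsilon> = (\<lambda>\<tau>. if \<tau> = 0 then hankel_kernel s N \<epsilon> 0 else
      if \<tau> = 2 * pi then hankel_kernel s N \<epsilon> (2 * pi) else g \<tau>)"
    unfolding g_def using hankel_kernel_decomposition[OF \<epsilon>] by auto
  have "hankel_kernel s N \<epsilon> \<in> borel_measurable lborel"
    by (subst eq) measurable
  moreover have "AE \<tau> in lborel. hankel_kernel s N \<epsilon> \<tau> = g \<tau>"
    using AE_lborel_singleton[of 0] AE_lborel_singleton[of "2 * pi"]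
    by eventually_elim (auto simp: g_def hankel_kernel_decomposition[OF \<epsilon>])
  ultimately show ?thesis using g by (subst has_bochner_integral_cong_AE) auto
qed

lemma Re_hankel_ge:
  assumes "\<epsilon> > 0" shows "Re (hankel \<epsilon> \<tau>) \<ge> - \<epsilon>"
proof -
  have "\<epsilon> * cos \<tau> \<ge> \<epsilon> * (-1)" using assms by (intro mult_left_mono) auto
  moreover have "\<tau> > 2 * pi \<Longrightarrow> \<epsilon> + \<tau> - 2 * pi > 0" using assms by linarith
  ultimately show ?thesis using assms
    by (auto simp: hankel_def hankel_log_def Re_exp intro: order_trans[of _ 0])
qed

text \<open>Separates N from \<tau>: the extra factor e^{-(N-1) Re x} is at most e^{\<epsilon>(N-1)}
  on the contour. A single integrable function thus dominates the kernels for all N >= 1, at the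
  price e^{\<epsilon>N}.\<close>

lemma norm_hankel_kernel_le:
  assumes \<epsilon>: "\<epsilon> > 0" and N: "N \<ge> 1"
  shows "norm (hankel_kernel s N \<epsilon> \<tau>) \<le> exp (\<epsilon> * N) * norm (hankel_kernel s 1 \<epsilon> \<tau>)"
proof -
  have "- (N * Re (hankel \<epsilon> \<tau>)) \<le> \<epsilon> * (N - 1) - Re (hankel \<epsilon> \<tau>)"
    using mult_left_mono[OF Re_hankel_ge[OF \<epsilon>, of \<tau>], of "N - 1"] N by (simp add: algebra_simps)
  also have "\<dots> \<le> \<epsilon> * N + - (1 * Re (hankel \<epsilon> \<tau>))" using \<epsilon> by (simp add: algebra_simps)
  finally have "exp (- (N * Re (hankel \<epsilon> \<tau>))) \<le> exp (\<epsilon> * N) * exp (- (1 * Re (hankel \<epsilon> \<tau>)))"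
    by (simp only: exp_le_cancel_iff exp_add[symmetric])
  hence "norm (gamma_fun (s - 1) N (hankel_log \<epsilon> \<tau>)) \<le> exp (\<epsilon> * N) * norm (gamma_fun (s - 1) 1 (hankel_log \<epsilon> \<tau>))"
    unfolding norm_gamma_fun hankel_def[symmetric] by (simp add: mult.left_commute mult_left_mono)
  thus ?thesis unfolding hankel_kernel_def norm_mult mult.assoc[symmetric]
    by (rule mult_right_mono) simp
qed

lemma hankel_kernel_mult_power:
  "hankel \<epsilon> \<tau> ^ l * hankel_kernel s N \<epsilon> \<tau> = hankel_kernel (s + of_nat l) N \<epsilon> \<tau>"
proof -
  have "exp w ^ l * gamma_fun s N w = gamma_fun (s + of_nat l) N w" for s w
    by (simp add: gamma_fun_def distrib_right exp_add exp_of_nat_mult)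
  from this[of "hankel_log \<epsilon> \<tau>" "s - 1"] show ?thesis
    by (simp add: hankel_kernel_def hankel_def algebra_simps)
qed

subsection \<open>Multiple polylogarithms at complex arguments\<close>

text \<open>The Weierstrass M-test for unordered sums: the remainder after a finite set F is
  bounded, uniformly in x, by the sum of M outside F.\<close>

lemma uniform_limit_infsum:
  fixes f :: "'i \<Rightarrow> 'a \<Rightarrow> 'b::banach"
  assumes bound: "\<And>x i. x \<in> A \<Longrightarrow> i \<in> S \<Longrightarrow> norm (f i x) \<le> M i" and M: "M summable_on S"
  shows "uniform_limit A (\<lambda>F x. \<Sum>i\<in>F. f i x) (\<lambda>x. infsum (\<lambda>i. f i x) S) (finite_subsets_at_top S)"
proof (rule uniform_limitI)
  fix e :: real assume "e > 0"
  have "(M has_sum infsum M S) S" using M by (rule has_sum_infsum)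
  hence "eventually (\<lambda>F. dist (sum M F) (infsum M S) < e) (finite_subsets_at_top S)"
    using \<open>e > 0\<close> unfolding has_sum_def by (rule tendstoD)
  moreover have "eventually (\<lambda>F. finite F \<and> F \<subseteq> S) (finite_subsets_at_top S)"
    by (rule eventually_finite_subsets_at_top_weakI) auto
  ultimately show "\<forall>\<^sub>F F in finite_subsets_at_top S. \<forall>x\<in>A. dist (\<Sum>i\<in>F. f i x) (infsum (\<lambda>i. f i x) S) < e"
  proof eventually_elim
    case (elim F)
    show ?case
    proof
      fix x assume x: "x \<in> A"
      have norm_le: "(\<lambda>i. norm (f i x)) summable_on T" if "T \<subseteq> S" for T
        using summable_on_subset_banach[OF M that] that bound[OF x]
        by (intro summable_on_comparison_test[OF summable_on_subset_banach[OF M that]]) auto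
      have f: "(\<lambda>i. f i x) summable_on T" if "T \<subseteq> S" for T
        using norm_le[OF that] by (rule abs_summable_summable)
      have "infsum (\<lambda>i. f i x) S = infsum (\<lambda>i. f i x) (F \<union> (S - F))"
        using elim by (simp add: Un_absorb1)
      also have "\<dots> = (\<Sum>i\<in>F. f i x) + infsum (\<lambda>i. f i x) (S - F)"
        using elim by (subst infsum_Un_disjoint) (auto intro!: f)
      finally have "dist (\<Sum>i\<in>F. f i x) (infsum (\<lambda>i. f i x) S) = norm (infsum (\<lambda>i. f i x) (S - F))"
        by (simp add: dist_norm)
      also have "\<dots> \<le> infsum (\<lambda>i. norm (f i x)) (S - F)"
        by (rule norm_infsum_bound) (rule norm_le, auto)
      also have "\<dots> \<le> infsum M (S - F)"
        using bound[OF x] by (intro infsum_mono norm_le summable_on_subset_banach[OF M]) auto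
      also have "infsum M S = infsum M (F \<union> (S - F))"
        using elim by (simp add: Un_absorb1)
      hence "infsum M (S - F) = infsum M S - sum M F"
        using elim by (subst (asm) infsum_Un_disjoint) (auto intro!: summable_on_subset_banach[OF M])
      also have "\<dots> < e" using elim by (simp add: dist_real_def)
      finally show "dist (\<Sum>i\<in>F. f i x) (infsum (\<lambda>i. f i x) S) < e" .
    qed
  qed
qed

text \<open>The power n_j^{-s_j} is written with the real logarithm of n_j, so that each term is
  visibly entire in s.\<close>

definition polylog_term :: "nat \<Rightarrow> real \<Rightarrow> (nat \<Rightarrow> nat) \<Rightarrow> (nat \<Rightarrow> complex) \<Rightarrow> complex" where
  "polylog_term r t n s = of_real t ^ n r * (\<Prod>j=1..r. exp (- s j * of_real (ln (real (n j)))))"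

definition polylog_c :: "nat \<Rightarrow> real \<Rightarrow> (nat \<Rightarrow> complex) \<Rightarrow> complex" where
  "polylog_c r t s = (\<Sum>\<^sub>\<infinity>n\<in>mono_tuples r. polylog_term r t n s)"

lemma polylog_c_of_int:
  assumes "\<And>j. j \<in> {1..r} \<Longrightarrow> s j = of_int (k j)"
  shows "polylog_c r t s = multi_polylog r k (of_real t)"
  unfolding polylog_c_def multi_polylog_def mono_tuples_def[symmetric] polylog_term_def
proof (intro infsum_cong)
  fix n assume n: "n \<in> mono_tuples r"
  have "exp (- s j * of_real (ln (real (n j)))) = inverse (of_nat (n j) powi k j)" if "j \<in> {1..r}" for j
  proof -
    have "n j > 0" using n that by (rule mono_tuples_pos)
    hence "exp (of_real (ln (real (n j)))) = (of_nat (n j) :: complex)"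
      by (simp add: exp_of_real)
    thus ?thesis using assms[OF that]
      by (simp add: exp_minus exp_power_int[symmetric])
  qed
  thus "of_real t ^ n r * (\<Prod>j=1..r. exp (- s j * of_real (ln (real (n j))))) =
      of_real t ^ n r / (\<Prod>j=1..r. of_nat (n j) powi k j)"
    by (simp add: divide_inverse prod_inversef[symmetric])
qed

text \<open>As n_j >= 1, the modulus of n_j^{-s_j} is at most n_j^R. The trivial factor
  \<open>exp (0 * real (n j))\<close> gives the majorant the shape of
  \<open>summable_on_mono_tuples\<close> at radius 0.\<close>

lemma norm_polylog_term_le:
  assumes n: "n \<in> mono_tuples r" and t: "0 < t" and R: "\<And>j. j \<in> {1..r} \<Longrightarrow> norm (s j) \<le> R"
  shows "norm (polylog_term r t n s) \<le> t ^ n r * (\<Prod>j=1..r. exp (0 * real (n j)) * real (n j) powr R)"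
proof -
  have "norm (exp (- s j * of_real (ln (real (n j))))) \<le> real (n j) powr R" if "j \<in> {1..r}" for j
  proof -
    have "n j > 0" using n that by (rule mono_tuples_pos)
    hence "ln (real (n j)) \<ge> 0" by simp
    moreover have "- Re (s j) \<le> R"
      using R[OF that] abs_Re_le_cmod[of "s j"] by linarith
    ultimately have "- Re (s j) * ln (real (n j)) \<le> R * ln (real (n j))"
      by (intro mult_right_mono) auto
    thus ?thesis using \<open>n j > 0\<close> by (simp add: powr_def)
  qed
  hence "(\<Prod>j=1..r. norm (exp (- s j * of_real (ln (real (n j)))))) \<le> (\<Prod>j=1..r. exp (0 * real (n j)) * real (n j) powr R)"
    by (intro prod_mono) auto
  thus ?thesis using t
    unfolding polylog_term_def norm_mult norm_power prod_norm[symmetric]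
    by (simp add: mult_left_mono)
qed

text \<open>The map \<open>\<sigma>\<close> lets one estimate serve two purposes: continuity, where
  z is itself a tuple, and holomorphy, where z is one complex variable on which the tuple
  depends.\<close>

lemma uniform_limit_polylog_c:
  assumes "r \<ge> 1" "0 < t" "t < 1" and R: "\<And>z j. z \<in> B \<Longrightarrow> j \<in> {1..r} \<Longrightarrow> norm (\<sigma> z j) \<le> R"
  shows "uniform_limit B (\<lambda>F z. \<Sum>n\<in>F. polylog_term r t n (\<sigma> z)) (\<lambda>z. polylog_c r t (\<sigma> z))
     (finite_subsets_at_top (mono_tuples r))"
  unfolding polylog_c_def
proof (rule uniform_limit_infsum)
  show "(\<lambda>n. t ^ n r * (\<Prod>j=1..r. exp (0 * real (n j)) * real (n j) powr R)) summable_on mono_tuples r"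
    by (rule summable_on_mono_tuples) (use assms in auto)
  fix z n assume "z \<in> B" "n \<in> mono_tuples r"
  thus "norm (polylog_term r t n (\<sigma> z)) \<le> t ^ n r * (\<Prod>j=1..r. exp (0 * real (n j)) * real (n j) powr R)"
    using R by (intro norm_polylog_term_le \<open>0 < t\<close>)
qed

lemma continuous_on_polylog_c:
  assumes rt: "r \<ge> 1" "0 < t" "t < 1"
  shows "continuous_on UNIV (polylog_c r t)"
proof (rule continuous_at_imp_continuous_on, rule ballI)
  fix s :: "nat \<Rightarrow> complex"
  \<comment> \<open>Only the finitely many coordinates 1..r are bounded, so \<open>B\<close> is open
    in the product topology.\<close>
  define B where "B = (\<Inter>j\<in>{1..r}. {z :: nat \<Rightarrow> complex. norm (z j) < norm (s j) + 1})"
  have "open B" unfolding B_def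
    by (intro open_INT ballI open_Collect_less continuous_intros) auto
  moreover have "s \<in> B" by (auto simp: B_def)
  moreover have "continuous_on B (\<lambda>z. polylog_c r t z)"
  proof (rule uniform_limit_theorem)
    show "uniform_limit B (\<lambda>F z. \<Sum>n\<in>F. polylog_term r t n z) (\<lambda>z. polylog_c r t z)
       (finite_subsets_at_top (mono_tuples r))"
    proof (rule uniform_limit_polylog_c[OF rt])
      fix z j assume "z \<in> B" "j \<in> {1..r}"
      hence "norm (z j) < norm (s j) + 1" by (auto simp: B_def)
      also have "norm (s j) \<le> (\<Sum>j=1..r. norm (s j))"
        using \<open>j \<in> {1..r}\<close> by (intro member_le_sum) auto
      finally show "norm (z j) \<le> (\<Sum>j=1..r. norm (s j)) + 1" by simp
    qed
    show "\<forall>\<^sub>F F in finite_subsets_at_top (mono_tuples r). continuous_on B (\<lambda>z. \<Sum>n\<in>F. polylog_term r t n z)"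
      unfolding polylog_term_def by (intro always_eventually allI continuous_intros
          continuous_on_subset[OF continuous_on_product_coordinates]) auto
  qed auto
  ultimately show "isCont (polylog_c r t) s"
    by (simp add: continuous_on_eq_continuous_at)
qed

text \<open>On each closed unit ball the arguments are bounded by compactness, so the finite partial
  sums converge uniformly there and the limit is holomorphic inside.\<close>

lemma holomorphic_on_polylog_c:
  assumes rt: "r \<ge> 1" "0 < t" "t < 1" and \<sigma>: "\<And>j. (\<lambda>z. \<sigma> z j) holomorphic_on UNIV"
  shows "(\<lambda>z. polylog_c r t (\<sigma> z)) holomorphic_on UNIV"
proof -
  have "(\<lambda>z. polylog_c r t (\<sigma> z)) holomorphic_on ball w 1" for w
  proof -
    have "compact ((\<lambda>z. \<sigma> z j) ` cball w 1)" for j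
      using holomorphic_on_imp_continuous_on[OF \<sigma>]
      by (intro compact_continuous_image) (auto intro: continuous_on_subset)
    hence "\<exists>R. \<forall>z\<in>cball w 1. norm (\<sigma> z j) \<le> R" for j
      by (meson bounded_iff compact_imp_bounded imageI)
    then obtain R where R: "norm (\<sigma> z j) \<le> R j" if "z \<in> cball w 1" for z j
      by metis
    have u: "uniform_limit (cball w 1) (\<lambda>F z. \<Sum>n\<in>F. polylog_term r t n (\<sigma> z)) (\<lambda>z. polylog_c r t (\<sigma> z))
       (finite_subsets_at_top (mono_tuples r))"
    proof (rule uniform_limit_polylog_c[OF rt])
      fix z j assume zj: "z \<in> cball w 1" "j \<in> {1..r}"
      have "norm (\<sigma> z j) \<le> R j" by (rule R) fact
      also have "\<dots> \<le> (\<Sum>j=1..r. \<bar>R j\<bar>)"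
        using zj member_le_sum[of j "{1..r}" "\<lambda>j. \<bar>R j\<bar>"] by auto
      finally show "norm (\<sigma> z j) \<le> (\<Sum>j=1..r. \<bar>R j\<bar>)" .
    qed
    have h: "(\<lambda>z. \<Sum>n\<in>F. polylog_term r t n (\<sigma> z)) holomorphic_on UNIV" for F
      unfolding polylog_term_def by (intro holomorphic_intros \<sigma>)
    show ?thesis
      by (rule holomorphic_uniform_limit[OF always_eventually u])
         (auto intro!: holomorphic_on_imp_continuous_on holomorphic_on_subset[OF h])
  qed
  hence "(\<lambda>z. polylog_c r t (\<sigma> z)) holomorphic_on (\<Union>w\<in>UNIV. ball w 1)"
    by (intro holomorphic_on_UN_open) auto
  moreover have "(\<Union>w\<in>UNIV. ball w 1) = (UNIV :: complex set)" by force
  ultimately show ?thesis by simp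
qed

definition des_monom :: "nat \<Rightarrow> real \<Rightarrow> expo \<Rightarrow> (nat \<Rightarrow> complex) \<Rightarrow> complex" where
  "des_monom r t e s = (\<Prod>j=1..r. pochhammer (s j) (Poly_Mapping.lookup (fst e) j)) *
     polylog_c r t (\<lambda>j. s j + of_int (Poly_Mapping.lookup (snd e) j))"

text \<open>The right-hand side of the theorem at complex arguments, with the sum over q cut at
  \<open>d\<close> and the inner sum over the keys. Being finite, it inherits continuity and
  holomorphy from the polylogarithms.\<close>

definition des_series :: "nat \<Rightarrow> nat \<Rightarrow> real \<Rightarrow> (nat \<Rightarrow> complex) \<Rightarrow> complex" where
  "des_series r d t s = (\<Sum>q\<le>d. (- of_real (ln t)) ^ q / fact q *
     (\<Sum>e\<in>Poly_Mapping.keys ((vderiv r ^^ q) (gen_G r)). of_int (coeff_a r q e) * des_monom r t e s))"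

lemma entire_des_series:
  assumes rt: "r \<ge> 1" "0 < t" "t < 1"
  shows "entire_on_Cr r (des_series r d t)"
  unfolding entire_on_Cr_def
proof (intro conjI ballI)
  have "continuous_on UNIV (\<lambda>s. polylog_c r t (\<lambda>j. s j + c j))" for c
    by (rule continuous_on_compose2[OF continuous_on_polylog_c[OF rt]])
       (auto intro!: continuous_on_coordinatewise_then_product continuous_intros)
  hence "continuous_on UNIV (des_series r d t)"
    unfolding des_series_def[abs_def] des_monom_def pochhammer_prod
    by (intro continuous_intros continuous_on_product_coordinates)
  thus "continuous_on ({1..r} \<rightarrow>\<^sub>E UNIV) (des_series r d t)"
    by (rule continuous_on_subset) auto
next
  fix s :: "nat \<Rightarrow> complex" and j
  have u: "(\<lambda>z. (s(j := z)) i) holomorphic_on UNIV" for i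
    by (cases "i = j") (auto intro!: holomorphic_intros)
  have "(\<lambda>z. polylog_c r t (\<lambda>i. (s(j := z)) i + c i)) holomorphic_on UNIV" for c
    using u by (intro holomorphic_on_polylog_c[OF rt] holomorphic_intros)
  thus "(\<lambda>z. des_series r d t (s(j := z))) holomorphic_on UNIV"
    unfolding des_series_def[abs_def] des_monom_def pochhammer_prod
    using u by (intro holomorphic_intros)
qed

subsection \<open>Integration over the product contour\<close>

lemma has_sum_finite_sum:
  fixes f :: "'i \<Rightarrow> 'a \<Rightarrow> 'b :: topological_comm_monoid_add"
  assumes "\<And>i. i \<in> I \<Longrightarrow> (f i has_sum s i) A"
  shows "((\<lambda>x. \<Sum>i\<in>I. f i x) has_sum (\<Sum>i\<in>I. s i)) A"
  using assms by (induction I rule: infinite_finite_induct) (auto intro!: has_sum_add)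

text \<open>Termwise integration with a majorant in product form: the norms of the integrals are
  bounded by b_i times the integral of h, hence summable. An infinite countable index set is
  enumerated to reduce to ordinary series.\<close>

lemma has_bochner_integral_infsum:
  fixes f :: "'i \<Rightarrow> 'a \<Rightarrow> 'b :: {banach, second_countable_topology}"
  assumes S: "countable S" and f: "\<And>i. i \<in> S \<Longrightarrow> has_bochner_integral M (f i) (I i)"
    and h: "integrable M h" and b: "b summable_on S"
    and bound: "\<And>i x. i \<in> S \<Longrightarrow> norm (f i x) \<le> b i * h x"
  shows "has_bochner_integral M (\<lambda>x. infsum (\<lambda>i. f i x) S) (infsum I S)"
proof (cases "finite S")
  case True
  thus ?thesis using f by (simp add: has_bochner_integral_sum)
next
  case False
  define g where "g = from_nat_into S"
  have g: "bij_betw g UNIV S"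
    using S False unfolding g_def by (rule bij_betw_from_nat_into)
  hence gS: "g n \<in> S" for n by (auto simp: bij_betw_def)
  have b': "summable (\<lambda>n. b (g n))"
    using b by (intro summable_on_imp_summable) (simp add: summable_on_reindex_bij_betw[OF g])
  have f': "integrable M (f (g n))" for n
    using f[OF gS] by (simp add: has_bochner_integral_iff)
  have sum1: "summable (\<lambda>n. norm (f (g n) x))" for x
    using bound[OF gS] by (intro summable_comparison_test'[OF summable_mult2[OF b', of "h x"]]) auto
  have le: "(LINT x|M. norm (f (g n) x)) \<le> b (g n) * (LINT x|M. h x)" for n
  proof -
    have "(LINT x|M. norm (f (g n) x)) \<le> (LINT x|M. b (g n) * h x)"
      using f' h bound[OF gS] by (intro integral_mono) auto
    thus ?thesis by simp
  qed
  have sum2: "summable (\<lambda>n. LINT x|M. norm (f (g n) x))"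
    using le by (intro summable_comparison_test'[OF summable_mult2[OF b', of "LINT x|M. h x"]]) auto
  have sum3: "summable (\<lambda>n. norm (I (g n)))"
  proof (rule summable_comparison_test'[OF sum2])
    fix n
    have "I (g n) = (LINT x|M. f (g n) x)" using f[OF gS] by (simp add: has_bochner_integral_iff)
    thus "norm (norm (I (g n))) \<le> (LINT x|M. norm (f (g n) x))" by (simp add: integral_norm_bound)
  qed
  have infsum_eq: "infsum F S = suminf (\<lambda>n. F (g n))" if "summable (\<lambda>n. norm (F (g n)))" for F :: "'i \<Rightarrow> 'b"
  proof -
    have "infsum F S = infsum (\<lambda>n. F (g n)) UNIV" by (rule infsum_reindex_bij_betw[OF g, symmetric])
    also have "\<dots> = suminf (\<lambda>n. F (g n))"
      using norm_summable_imp_has_sum[OF that summable_sums[OF summable_norm_cancel[OF that]]] by (rule infsumI)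
    finally show ?thesis .
  qed
  have "has_bochner_integral M (\<lambda>x. suminf (\<lambda>n. f (g n) x)) (suminf (\<lambda>n. LINT x|M. f (g n) x))"
    using integrable_suminf[OF f' _ sum2] integral_suminf[OF f' _ sum2] sum1
    by (simp add: has_bochner_integral_iff)
  moreover have "(LINT x|M. f (g n) x) = I (g n)" for n
    using f[OF gS] by (simp add: has_bochner_integral_iff)
  ultimately show ?thesis
    by (simp add: infsum_eq[OF sum1] infsum_eq[OF sum3])
qed

text \<open>The share of one monomial and one tuple in the integrand, at v_j = 1 / n_j and u_j = n_j
  x_j; the powers of x_j are absorbed into the parameter of the kernel.\<close>

definition hankel_term ::
  "nat \<Rightarrow> (nat \<Rightarrow> complex) \<Rightarrow> real \<Rightarrow> real \<Rightarrow> expo \<Rightarrow> (nat \<Rightarrow> nat) \<Rightarrow> (nat \<Rightarrow> real) \<Rightarrow> complex" where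
  "hankel_term r s t \<epsilon> e n \<tau> = of_real t ^ n r *
     (\<Prod>j=1..r. of_nat (n j) ^ Poly_Mapping.lookup (fst e) j *
        inverse (of_nat (n j)) powi Poly_Mapping.lookup (snd e) j *
        hankel_kernel (s j + of_nat (Poly_Mapping.lookup (fst e) j)) (real (n j)) \<epsilon> (\<tau> j))"

definition hankel_constant :: "complex \<Rightarrow> complex" where
  "hankel_constant s = (exp (2 * of_real pi * \<i> * s) - 1) * Gamma s"

lemma hankel_constant_nonzero:
  assumes "s \<notin> \<int>"
  shows "hankel_constant s \<noteq> 0"
proof -
  have "s \<notin> \<int>\<^sub>\<le>\<^sub>0" using assms by (auto elim!: nonpos_Ints_cases)
  hence "Gamma s \<noteq> 0" by (rule Gamma_nonzero)
  moreover have "exp (2 * of_real pi * \<i> * s) \<noteq> 1"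
  proof
    assume "exp (2 * of_real pi * \<i> * s) = 1"
    then obtain n :: int where "Im s = 0" "Re s = of_int n"
      by (auto simp: exp_eq_1)
    hence "s = of_int n" by (simp add: complex_eq_iff)
    thus False using assms by simp
  qed
  ultimately show ?thesis by (simp add: hankel_constant_def)
qed

text \<open>The origin of the Pochhammer symbols and of the shift k + m: Gamma (s + l) is (s)_l
  Gamma s, the factor n^l from u_j cancels against n^{-(s+l)}, v_j^m supplies n^{-m}, and e^{2 pi i
  s} does not see the integer l.\<close>

lemma hankel_value_shift:
  assumes s: "s \<notin> \<int>" and N: "n > 0" and \<epsilon>: "\<epsilon> > 0"
  shows "of_nat n ^ l * inverse (of_nat n) powi m * hankel_value (s + of_nat l) (real n) \<epsilon> =
    hankel_constant s * pochhammer s l * exp (- (s + of_int m) * of_real (ln (real n)))"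
proof -
  have "s + of_nat l \<notin> \<int>" using s Ints_diff[of "s + of_nat l" "of_nat l"] by auto
  hence 1: "hankel_value (s + of_nat l) (real n) \<epsilon> = (exp (2 * of_real pi * \<i> * (s + of_nat l)) - 1) *
      Gamma (s + of_nat l) * exp (- (s + of_nat l) * of_real (ln (real n)))"
    using N \<epsilon> by (intro hankel_value_eq) auto
  have 2: "exp (2 * of_real pi * \<i> * (s + of_nat l)) = exp (2 * of_real pi * \<i> * s)"
  proof -
    have "exp (2 * of_real pi * \<i> * of_nat l) = 1"
      by (metis exp_of_nat2_mult exp_two_pi_i mult.commute power_one)
    thus ?thesis by (simp add: distrib_left exp_add)
  qed
  have "s \<notin> \<int>\<^sub>\<le>\<^sub>0" using s by (auto elim!: nonpos_Ints_cases)
  hence 3: "Gamma (s + of_nat l) = pochhammer s l * Gamma s"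
    using pochhammer_Gamma[of s l] Gamma_nonzero[of s] by simp
  have nexp: "of_nat n = exp (of_real (ln (real n)) :: complex)"
    using N by (simp add: exp_of_real)
  have 4: "of_nat n ^ l * inverse (of_nat n) powi m * exp (- (s + of_nat l) * of_real (ln (real n))) =
      exp (- (s + of_int m) * of_real (ln (real n)))"
    unfolding nexp exp_minus[symmetric] exp_power_int exp_of_nat_mult[symmetric] exp_add[symmetric]
    by (simp add: algebra_simps)
  show ?thesis unfolding 1 2 3 hankel_constant_def 4[symmetric] by (simp add: mult_ac)
qed

lemma has_bochner_integral_hankel_term:
  assumes s: "\<And>j. j \<in> {1..r} \<Longrightarrow> s j \<notin> \<int>" and n: "n \<in> mono_tuples r" and \<epsilon>: "\<epsilon> > 0"
  shows "has_bochner_integral (Pi\<^sub>M {1..r} (\<lambda>_. lborel)) (hankel_term r s t \<epsilon> e n)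
    ((\<Prod>j=1..r. hankel_constant (s j)) * (\<Prod>j=1..r. pochhammer (s j) (Poly_Mapping.lookup (fst e) j)) *
     polylog_term r t n (\<lambda>j. s j + of_int (Poly_Mapping.lookup (snd e) j)))"
proof -
  interpret product_sigma_finite "\<lambda>_::nat. lborel :: real measure" by standard
  let ?l = "Poly_Mapping.lookup (fst e)" and ?m = "Poly_Mapping.lookup (snd e)"
  let ?f = "\<lambda>j \<tau>. of_nat (n j) ^ ?l j * inverse (of_nat (n j)) powi ?m j * hankel_kernel (s j + of_nat (?l j)) (real (n j)) \<epsilon> \<tau>"
  have f: "has_bochner_integral lborel (?f j) (hankel_constant (s j) * pochhammer (s j) (?l j) * exp (- (s j + of_int (?m j)) * of_real (ln (real (n j)))))"
    if j: "j \<in> {1..r}" for j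
    using mono_tuples_pos[OF n j] \<epsilon>
    unfolding hankel_value_shift[OF s[OF j] mono_tuples_pos[OF n j] \<epsilon>, symmetric]
    by (intro has_bochner_integral_mult_right has_bochner_integral_hankel_kernel) auto
  have "has_bochner_integral (Pi\<^sub>M {1..r} (\<lambda>_. lborel)) (\<lambda>\<tau>. \<Prod>j=1..r. ?f j (\<tau> j))
      (\<Prod>j=1..r. hankel_constant (s j) * pochhammer (s j) (?l j) * exp (- (s j + of_int (?m j)) * of_real (ln (real (n j)))))"
    using f product_integrable_prod[of "{1..r}" ?f] product_integral_prod[of "{1..r}" ?f]
    by (simp add: has_bochner_integral_iff)
  hence "has_bochner_integral (Pi\<^sub>M {1..r} (\<lambda>_. lborel)) (\<lambda>\<tau>. of_real t ^ n r * (\<Prod>j=1..r. ?f j (\<tau> j)))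
      (of_real t ^ n r * (\<Prod>j=1..r. hankel_constant (s j) * pochhammer (s j) (?l j) * exp (- (s j + of_int (?m j)) * of_real (ln (real (n j))))))"
    by (rule has_bochner_integral_mult_right[rotated])
  thus ?thesis
    unfolding hankel_term_def[abs_def] polylog_term_def prod.distrib by (simp only: mult_ac)
qed

text \<open>A coefficient depending on the tuple times one function of \<tau>, the product shape
  expected by \<open>has_bochner_integral_infsum\<close>.\<close>

lemma norm_hankel_term_le:
  assumes n: "n \<in> mono_tuples r" and \<epsilon>: "\<epsilon> > 0" and t: "t > 0"
  shows "norm (hankel_term r s t \<epsilon> e n \<tau>) \<le>
    (t ^ n r * (\<Prod>j=1..r. exp (\<epsilon> * real (n j)) *
       real (n j) powr (real (Poly_Mapping.lookup (fst e) j) - of_int (Poly_Mapping.lookup (snd e) j)))) *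
    (\<Prod>j=1..r. norm (hankel_kernel (s j + of_nat (Poly_Mapping.lookup (fst e) j)) 1 \<epsilon> (\<tau> j)))"
proof -
  let ?l = "Poly_Mapping.lookup (fst e)" and ?m = "Poly_Mapping.lookup (snd e)"
  have *: "norm (of_nat (n j) ^ ?l j * inverse (of_nat (n j) :: complex) powi ?m j *
        hankel_kernel (s j + of_nat (?l j)) (real (n j)) \<epsilon> (\<tau> j)) \<le>
      exp (\<epsilon> * real (n j)) * real (n j) powr (real (?l j) - of_int (?m j)) *
        norm (hankel_kernel (s j + of_nat (?l j)) 1 \<epsilon> (\<tau> j))" if j: "j \<in> {1..r}" for j
  proof -
    have nj: "n j > 0" using n j by (rule mono_tuples_pos)
    have "norm (of_nat (n j) ^ ?l j * inverse (of_nat (n j) :: complex) powi ?m j) = real (n j) powr (real (?l j) - of_int (?m j))"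
      using nj by (simp add: norm_mult norm_power norm_power_int norm_inverse powr_diff powr_realpow
          powr_real_of_int' power_int_inverse divide_inverse)
    moreover have "real (n j) powr (real (?l j) - of_int (?m j)) * norm (hankel_kernel (s j + of_nat (?l j)) (real (n j)) \<epsilon> (\<tau> j)) \<le>
        real (n j) powr (real (?l j) - of_int (?m j)) *
          (exp (\<epsilon> * real (n j)) * norm (hankel_kernel (s j + of_nat (?l j)) 1 \<epsilon> (\<tau> j)))"
      using nj \<epsilon> by (intro mult_left_mono norm_hankel_kernel_le) auto
    ultimately show ?thesis
      by (subst norm_mult) (simp only: mult_ac)
  qed
  have "(\<Prod>j=1..r. norm (of_nat (n j) ^ ?l j * inverse (of_nat (n j) :: complex) powi ?m j *
        hankel_kernel (s j + of_nat (?l j)) (real (n j)) \<epsilon> (\<tau> j))) \<le>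
      (\<Prod>j=1..r. exp (\<epsilon> * real (n j)) * real (n j) powr (real (?l j) - of_int (?m j)) *
        norm (hankel_kernel (s j + of_nat (?l j)) 1 \<epsilon> (\<tau> j)))"
    using * by (intro prod_mono) auto
  thus ?thesis
    unfolding hankel_term_def norm_mult[of "_ ^ _"] norm_power prod_norm[symmetric]
    using t by (simp add: prod.distrib mult.assoc mult_left_mono)
qed

lemma summable_on_hankel_bound:
  assumes "r \<ge> 1" "0 < t" "t < 1" "real r * \<epsilon> < - ln t"
  shows "(\<lambda>n. t ^ n r * (\<Prod>j=1..r. exp (\<epsilon> * real (n j)) *
       real (n j) powr (real (Poly_Mapping.lookup (fst e) j) - of_int (Poly_Mapping.lookup (snd e) j)))) summable_on mono_tuples r"
  using assms by (rule summable_on_mono_tuples)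

lemma summable_on_hankel_term:
  assumes "r \<ge> 1" "0 < t" "t < 1" "real r * \<epsilon> < - ln t" "\<epsilon> > 0"
  shows "(\<lambda>n. hankel_term r s t \<epsilon> e n \<tau>) summable_on mono_tuples r"
proof (rule abs_summable_summable, rule summable_on_comparison_test)
  show "norm (hankel_term r s t \<epsilon> e n \<tau>) \<le>
    (t ^ n r * (\<Prod>j=1..r. exp (\<epsilon> * real (n j)) *
       real (n j) powr (real (Poly_Mapping.lookup (fst e) j) - of_int (Poly_Mapping.lookup (snd e) j)))) *
    (\<Prod>j=1..r. norm (hankel_kernel (s j + of_nat (Poly_Mapping.lookup (fst e) j)) 1 \<epsilon> (\<tau> j)))"
    if "n \<in> mono_tuples r" for n
    by (rule norm_hankel_term_le[OF that assms(5,2)])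
qed (intro summable_on_cmult_left summable_on_hankel_bound assms norm_ge_zero)+

lemma has_bochner_integral_hankel_series:
  assumes rt: "r \<ge> 1" "0 < t" "t < 1" and \<epsilon>: "real r * \<epsilon> < - ln t" "\<epsilon> > 0"
    and s: "\<And>j. j \<in> {1..r} \<Longrightarrow> s j \<notin> \<int>"
  shows "has_bochner_integral (Pi\<^sub>M {1..r} (\<lambda>_. lborel)) (\<lambda>\<tau>. \<Sum>\<^sub>\<infinity>n\<in>mono_tuples r. hankel_term r s t \<epsilon> e n \<tau>)
    ((\<Prod>j=1..r. hankel_constant (s j)) * des_monom r t e s)"
proof -
  interpret product_sigma_finite "\<lambda>_::nat. lborel :: real measure" by standard
  let ?l = "Poly_Mapping.lookup (fst e)"
  have h: "integrable (Pi\<^sub>M {1..r} (\<lambda>_. lborel))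
      (\<lambda>\<tau>. \<Prod>j=1..r. norm (hankel_kernel (s j + of_nat (?l j)) 1 \<epsilon> (\<tau> j)))"
    using has_bochner_integral_hankel_kernel[OF \<epsilon>(2), of 1]
    by (intro product_integrable_prod integrable_norm) (auto simp: has_bochner_integral_iff)
  note has_bochner_integral_infsum[OF countable_mono_tuples has_bochner_integral_hankel_term[OF s _ \<epsilon>(2)] h
      summable_on_hankel_bound[OF rt \<epsilon>(1)] norm_hankel_term_le[OF _ \<epsilon>(2) rt(2)]]
  thus ?thesis
    by (simp add: infsum_cmult_right' des_monom_def polylog_c_def mult.assoc)
qed

lemma hankel_integrand_series:
  assumes rt: "r \<ge> 1" "0 < t" "t < 1" and \<epsilon>: "real r * \<epsilon> < - ln t" "\<epsilon> > 0"
    and d: "\<forall>e\<in>Poly_Mapping.keys (gen_G r). Poly_Mapping.lookup (fst e) r \<le> d"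
  shows "(\<Prod>j=1..r. des_factor t (\<Sum>k=j..r. hankel \<epsilon> (\<tau> k))) *
        (\<Prod>k=1..r. exp ((s k - 1) * hankel_log \<epsilon> (\<tau> k)) * vector_derivative (hankel \<epsilon>) (at (\<tau> k))) =
    (\<Sum>q\<le>d. \<Sum>e\<in>Poly_Mapping.keys ((vderiv r ^^ q) (gen_G r)).
       (- of_real (ln t)) ^ q / fact q * of_int (coeff_a r q e) *
       (\<Sum>\<^sub>\<infinity>n\<in>mono_tuples r. hankel_term r s t \<epsilon> e n \<tau>))"
proof -
  define x where "x = (\<lambda>j. hankel \<epsilon> (\<tau> j))"
  let ?K = "\<Prod>k=1..r. exp ((s k - 1) * hankel_log \<epsilon> (\<tau> k)) * vector_derivative (hankel \<epsilon>) (at (\<tau> k))"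
  let ?c = "\<lambda>q e. (- of_real (ln t)) ^ q / fact q * of_int (coeff_a r q e) :: complex"
  let ?keys = "\<lambda>q. Poly_Mapping.keys ((vderiv r ^^ q) (gen_G r))"
  have x: "Re (\<Sum>k=j..r. x k) > ln t" if "j \<in> {1..r}" for j
  proof -
    have "real r * \<epsilon> \<ge> real (card {j..r}) * \<epsilon>"
      using that \<epsilon> by (intro mult_right_mono) auto
    hence "real (card {j..r}) * \<epsilon> < - ln t" using \<epsilon> by linarith
    hence "ln t < (\<Sum>k=j..r. - \<epsilon>)" by simp
    also have "\<dots> \<le> (\<Sum>k=j..r. Re (x k))"
      unfolding x_def by (intro sum_mono Re_hankel_ge \<epsilon>)
    finally show ?thesis by simp
  qed
  have "(\<Prod>j=1..r. des_factor t (\<Sum>k=j..r. x k)) * ?K =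
      (\<Sum>\<^sub>\<infinity>n\<in>mono_tuples r. of_real t ^ n r *
       (\<Prod>j=1..r. 1 + of_nat (n j - previous n j) * (of_real (ln t) - (\<Sum>k=j..r. x k))) *
       (\<Prod>j=1..r. exp (- of_nat (n j) * x j)) * ?K)"
    by (subst prod_des_factor_series[OF rt(1,2)]) (simp_all only: x infsum_cmult_left')
  also have "\<dots> = (\<Sum>\<^sub>\<infinity>n\<in>mono_tuples r. \<Sum>q\<le>d. \<Sum>e\<in>?keys q. ?c q e * hankel_term r s t \<epsilon> e n \<tau>)"
  proof (intro infsum_cong)
    fix n assume n: "n \<in> mono_tuples r"
    define v :: "nat \<Rightarrow> complex" where "v = (\<lambda>j. inverse (of_nat (n j)))"
    define u where "u = (\<lambda>j. x j * of_nat (n j))"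
    define u' where "u' = u(r := u r + (- of_real (ln t)) / v r)"
    have v: "\<forall>j\<in>{1..r}. v j \<noteq> 0" using mono_tuples_pos[OF n] by (auto simp: v_def)
    have u'v: "u' j * v j = (if j = r then x j - of_real (ln t) else x j)" if "j \<in> {1..r}" for j
      using v that unfolding u'_def u_def by (auto simp: v_def field_simps)
    have "1 + of_nat (n j - previous n j) * (of_real (ln t) - (\<Sum>k=j..r. x k)) =
        1 - (\<Sum>i=j..r. u' i * v i) * (inverse (v j) - (if j = 1 then 0 else inverse (v (j - 1))))"
      if j: "j \<in> {1..r}" for j
    proof -
      \<comment> \<open>The index r lies in every range j..r, so log t is subtracted exactly once
        for each j.\<close>
      have "(\<Sum>i=j..r. u' i * v i) = (\<Sum>i=j..r. x i - (if i = r then of_real (ln t) else 0))"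
        using j by (intro sum.cong) (auto simp: u'v)
      also have "\<dots> = (\<Sum>i=j..r. x i) - of_real (ln t)"
        using j by (simp add: sum_subtractf)
      finally have 1: "(\<Sum>i=j..r. u' i * v i) = (\<Sum>i=j..r. x i) - of_real (ln t)" .
      have 2: "inverse (v j) - (if j = 1 then 0 else inverse (v (j - 1))) = of_nat (n j - previous n j)"
        using less_imp_le[OF mono_tuples_previous_less[OF n j]]
        by (simp add: of_nat_diff v_def previous_def)
      show ?thesis unfolding 1 2 by (simp add: algebra_simps)
    qed
    hence "(\<Prod>j=1..r. 1 + of_nat (n j - previous n j) * (of_real (ln t) - (\<Sum>k=j..r. x k))) =
        laurent_eval r u' v (gen_G r)"
      unfolding laurent_eval_gen_G[OF v] by (intro prod.cong) auto
    also have "\<dots> = (\<Sum>q\<le>d. (- of_real (ln t)) ^ q / fact q * laurent_eval r u v ((vderiv r ^^ q) (gen_G r)))"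
      unfolding u'_def by (rule laurent_taylor[OF rt(1) v d, symmetric])
    also have "\<dots> = (\<Sum>q\<le>d. \<Sum>e\<in>?keys q. ?c q e * laurent_monom r u v e)"
      unfolding laurent_eval_def coeff_a_eq[symmetric] sum_distrib_left mult.assoc ..
    finally have E: "(\<Prod>j=1..r. 1 + of_nat (n j - previous n j) * (of_real (ln t) - (\<Sum>k=j..r. x k))) =
        (\<Sum>q\<le>d. \<Sum>e\<in>?keys q. ?c q e * laurent_monom r u v e)" .
    have T: "of_real t ^ n r * laurent_monom r u v e * (\<Prod>j=1..r. exp (- of_nat (n j) * x j)) * ?K =
        hankel_term r s t \<epsilon> e n \<tau>" for e
    proof -
      have "laurent_monom r u v e * ((\<Prod>j=1..r. exp (- of_nat (n j) * x j)) * ?K) =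
        (\<Prod>j=1..r. of_nat (n j) ^ Poly_Mapping.lookup (fst e) j *
          inverse (of_nat (n j)) powi Poly_Mapping.lookup (snd e) j *
          hankel_kernel (s j + of_nat (Poly_Mapping.lookup (fst e) j)) (real (n j)) \<epsilon> (\<tau> j))"
        unfolding laurent_monom_def prod.distrib[symmetric] hankel_kernel_mult_power[symmetric]
        by (intro prod.cong refl)
           (simp add: hankel_kernel_def gamma_fun_def u_def v_def x_def hankel_def power_mult_distrib mult_ac)
      thus ?thesis unfolding hankel_term_def by (simp only: mult.assoc)
    qed
    show "of_real t ^ n r *
       (\<Prod>j=1..r. 1 + of_nat (n j - previous n j) * (of_real (ln t) - (\<Sum>k=j..r. x k))) *
       (\<Prod>j=1..r. exp (- of_nat (n j) * x j)) * ?K =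
       (\<Sum>q\<le>d. \<Sum>e\<in>?keys q. ?c q e * hankel_term r s t \<epsilon> e n \<tau>)"
      unfolding E T[symmetric] sum_distrib_left sum_distrib_right by (simp only: mult_ac)
  qed
  also have "\<dots> = (\<Sum>q\<le>d. \<Sum>e\<in>?keys q. ?c q e * (\<Sum>\<^sub>\<infinity>n\<in>mono_tuples r. hankel_term r s t \<epsilon> e n \<tau>))"
    by (intro infsumI has_sum_finite_sum has_sum_cmult_right has_sum_infsum
        summable_on_hankel_term rt \<epsilon>)
  finally show ?thesis unfolding x_def .
qed

lemma hankel_integral_eq:
  assumes rt: "r \<ge> 1" "0 < t" "t < 1" and \<epsilon>: "real r * \<epsilon> < - ln t" "\<epsilon> > 0"
    and d: "\<forall>e\<in>Poly_Mapping.keys (gen_G r). Poly_Mapping.lookup (fst e) r \<le> d"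
    and s: "\<And>j. j \<in> {1..r} \<Longrightarrow> s j \<notin> \<int>"
  shows "hankel_integral r s t \<epsilon> = (\<Prod>j=1..r. hankel_constant (s j)) * des_series r d t s"
proof -
  have "hankel_integral r s t \<epsilon> = (\<Sum>q\<le>d. \<Sum>e\<in>Poly_Mapping.keys ((vderiv r ^^ q) (gen_G r)).
       (- of_real (ln t)) ^ q / fact q * of_int (coeff_a r q e) *
       ((\<Prod>j=1..r. hankel_constant (s j)) * des_monom r t e s))"
    unfolding hankel_integral_def hankel_integrand_series[OF rt \<epsilon> d]
    by (intro has_bochner_integral_integral_eq has_bochner_integral_sum has_bochner_integral_mult_right
        has_bochner_integral_hankel_series rt \<epsilon> s)
  also have "\<dots> = (\<Prod>j=1..r. hankel_constant (s j)) * des_series r d t s"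
    unfolding des_series_def sum_distrib_left by (simp add: mult_ac)
  finally show ?thesis .
qed

section \<open>From the contour integral to integer points\<close>

lemma zeta_des_nonint_eq:
  assumes rt: "r \<ge> 1" "0 < t" "t < 1"
    and d: "\<forall>e\<in>Poly_Mapping.keys (gen_G r). Poly_Mapping.lookup (fst e) r \<le> d"
    and s: "\<And>j. j \<in> {1..r} \<Longrightarrow> s j \<notin> \<int>"
  shows "zeta_des_nonint r s t = des_series r d t s"
proof -
  let ?C = "\<Prod>j=1..r. hankel_constant (s j)"
  have "- ln t / real r > 0" using rt by (intro divide_pos_pos) auto
  hence "\<forall>\<^sub>F \<epsilon> in at_right 0. \<epsilon> \<in> {0<..<- ln t / real r}" by (rule eventually_at_right_real)
  hence ev: "\<forall>\<^sub>F \<epsilon> in at_right 0. hankel_integral r s t \<epsilon> = ?C * des_series r d t s"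
  proof eventually_elim
    case (elim \<epsilon>)
    thus ?case using rt by (intro hankel_integral_eq rt d s) (auto simp: field_simps)
  qed
  have "(THE w. \<forall>\<^sub>F \<epsilon> in at_right 0. hankel_integral r s t \<epsilon> = w) = ?C * des_series r d t s"
  proof (rule the_equality)
    show "\<forall>\<^sub>F \<epsilon> in at_right 0. hankel_integral r s t \<epsilon> = ?C * des_series r d t s" by (rule ev)
    \<comment> \<open>Both eventual equations hold at a common radius, since the filter
      \<open>at_right 0\<close> is nontrivial.\<close>
    fix w assume "\<forall>\<^sub>F \<epsilon> in at_right 0. hankel_integral r s t \<epsilon> = w"
    with ev have "\<forall>\<^sub>F \<epsilon> in at_right (0::real). w = ?C * des_series r d t s"
      by eventually_elim simp
    thus "w = ?C * des_series r d t s" by simp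
  qed
  moreover have "(\<Prod>j=1..r. 1 / hankel_constant (s j)) * ?C = 1"
    unfolding prod.distrib[symmetric] using hankel_constant_nonzero[OF s] by (intro prod.neutral) auto
  ultimately show ?thesis
    unfolding zeta_des_nonint_def hankel_constant_def[symmetric] by (simp add: mult.assoc[symmetric])
qed

text \<open>The series itself witnesses that an extension exists, so the chosen one has the required
  properties. Both agree wherever no coordinate is an integer, and continuity carries the equality
  to the limit point.\<close>

lemma zeta_des_of_int:
  assumes rt: "r \<ge> 1" "0 < t" "t < 1"
    and d: "\<forall>e\<in>Poly_Mapping.keys (gen_G r). Poly_Mapping.lookup (fst e) r \<le> d"
  shows "zeta_des r (\<lambda>j. of_int (k j)) t = des_series r d t (restrict (\<lambda>j. of_int (k j)) {1..r})"
proof -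
  let ?P = "\<lambda>F. entire_on_Cr r F \<and> (\<forall>z \<in> {1..r} \<rightarrow>\<^sub>E (- \<int>). F z = zeta_des_nonint r z t)"
  let ?k = "restrict (\<lambda>j. of_int (k j)) {1..r} :: nat \<Rightarrow> complex"
  define F where "F = (SOME F. ?P F)"
  have eq: "zeta_des_nonint r z t = des_series r d t z" if "z \<in> {1..r} \<rightarrow>\<^sub>E (- \<int>)" for z
    using that by (intro zeta_des_nonint_eq[OF rt d]) auto
  have "?P (des_series r d t)" using eq entire_des_series[OF rt] by auto
  hence F: "?P F" unfolding F_def by (rule someI[of ?P])
  \<comment> \<open>All coordinates are moved off the integers together. The offset 1 / (n + 2) lies
    strictly between 0 and 1 for every n, including n = 0.\<close>
  define z where "z = (\<lambda>n. restrict (\<lambda>j. of_int (k j) + of_real (1 / real (n + 2))) {1..r} :: nat \<Rightarrow> complex)"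
  have z: "z n \<in> {1..r} \<rightarrow>\<^sub>E (- \<int>)" for n
  proof -
    have "of_int (k j) + of_real (1 / real (n + 2)) \<notin> (\<int> :: complex set)" for j
    proof
      assume "of_int (k j) + of_real (1 / real (n + 2)) \<in> (\<int> :: complex set)"
      from Ints_diff[OF this Ints_of_int[of "k j"]] have "of_real (1 / real (n + 2)) \<in> (\<int> :: complex set)" by simp
      then obtain i :: int where "of_real (1 / real (n + 2)) = (of_int i :: complex)" by (auto elim: Ints_cases)
      hence "1 / real (n + 2) = of_int i" by (metis of_real_eq_iff of_real_of_int_eq)
      moreover have "0 < 1 / real (n + 2)" "1 / real (n + 2) < 1" by auto
      ultimately show False by simp
    qed
    thus ?thesis by (auto simp: z_def)
  qed
  have "(\<lambda>n. 1 / real (n + 2)) \<longlonglongrightarrow> 0" by real_asymp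
  hence "(\<lambda>n. of_real (1 / real (n + 2)) :: complex) \<longlonglongrightarrow> of_real 0" by (rule tendsto_of_real)
  hence "(\<lambda>n. of_int (k j) + of_real (1 / real (n + 2)) :: complex) \<longlonglongrightarrow> of_int (k j) + of_real 0" for j
    by (intro tendsto_add tendsto_const)
  hence "(\<lambda>n. z n j) \<longlonglongrightarrow> ?k j" for j by (auto simp: z_def)
  \<comment> \<open>Convergence in the product topology is coordinatewise; outside 1..r both sides
    are the same default value.\<close>
  hence lim: "z \<longlonglongrightarrow> ?k"
    using limitin_componentwise[of "\<lambda>_. euclidean" UNIV z ?k sequentially]
    by (simp add: euclidean_product_topology flip: limitin_canonical_iff)
  have *: "(\<lambda>n. G (z n)) \<longlonglongrightarrow> G ?k" if "entire_on_Cr r G" for G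
  proof (rule continuous_on_tendsto_compose[OF _ lim])
    show "continuous_on ({1..r} \<rightarrow>\<^sub>E UNIV) G" using that by (simp add: entire_on_Cr_def)
    show "\<forall>\<^sub>F n in sequentially. z n \<in> {1..r} \<rightarrow>\<^sub>E UNIV" by (auto simp: z_def)
  qed auto
  have "(\<lambda>n. F (z n)) = (\<lambda>n. des_series r d t (z n))"
    using F z eq by auto
  hence "F ?k = des_series r d t ?k"
    using *[of F] F *[OF entire_des_series[OF rt, of d]] LIMSEQ_unique by metis
  thus ?thesis unfolding zeta_des_def F_def .
qed

text \<open>Both infinite sums of the theorem have finite support: the coefficients vanish off the
  keys, and the iterated operator kills G_r once q exceeds \<open>d\<close>.\<close>

lemma des_series_restrict_of_int:
  assumes r: "r \<ge> 1"
    and d: "\<forall>e\<in>Poly_Mapping.keys (gen_G r). Poly_Mapping.lookup (fst e) r \<le> d"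
  shows "des_series r d t (restrict (\<lambda>j. of_int (k j)) {1..r}) =
    (\<Sum>\<^sub>\<infinity>q::nat. (-1) ^ q * (of_real (ln t) ^ q / fact q) *
       (\<Sum>\<^sub>\<infinity>(l, m)\<in>expos r q.
          of_int (coeff_a r q (l, m)) *
          (\<Prod>j=1..r. pochhammer (of_int (k j)) (Poly_Mapping.lookup l j)) *
          multi_polylog r (\<lambda>j. k j + Poly_Mapping.lookup m j) (of_real t)))"
    (is "_ = (\<Sum>\<^sub>\<infinity>q. ?c q * (\<Sum>\<^sub>\<infinity>(l, m)\<in>expos r q. ?f q l m))")
proof -
  let ?keys = "\<lambda>q. Poly_Mapping.keys ((vderiv r ^^ q) (gen_G r))"
  have a0: "coeff_a r q e = 0" if "e \<notin> ?keys q" for q e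
    using that by (simp add: coeff_a_eq in_keys_iff)
  have inner: "(\<Sum>\<^sub>\<infinity>(l, m)\<in>expos r q. ?f q l m) = (\<Sum>(l, m)\<in>?keys q. ?f q l m)" for q
  proof -
    have "(\<Sum>\<^sub>\<infinity>(l, m)\<in>expos r q. ?f q l m) = (\<Sum>\<^sub>\<infinity>(l, m)\<in>?keys q. ?f q l m)"
      using keys_vderiv_gen_G[of q r] a0 by (intro infsum_cong_neutral) auto
    thus ?thesis by simp
  qed
  have "(\<Sum>\<^sub>\<infinity>q. ?c q * (\<Sum>(l, m)\<in>?keys q. ?f q l m)) = (\<Sum>\<^sub>\<infinity>q\<in>{..d}. ?c q * (\<Sum>(l, m)\<in>?keys q. ?f q l m))"
  proof (intro infsum_cong_neutral)
    fix q assume "q \<in> UNIV - {..d}"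
    hence "(vderiv r ^^ q) (gen_G r) = 0"
      using d by (intro vderiv_funpow_eq_0[OF r]) (meson DiffD2 atMost_iff le_less_trans not_le)
    thus "?c q * (\<Sum>(l, m)\<in>?keys q. ?f q l m) = 0" by simp
  qed auto
  also have "\<dots> = (\<Sum>q\<le>d. ?c q * (\<Sum>(l, m)\<in>?keys q. ?f q l m))"
    by simp
  also have "\<dots> = des_series r d t (restrict (\<lambda>j. of_int (k j)) {1..r})"
    unfolding des_series_def
  proof (intro sum.cong refl arg_cong2[where f = "(*)"])
    show "?c q = (- of_real (ln t)) ^ q / fact q" for q
      by (simp add: power_minus[of "of_real (ln t)"])
    fix q e assume "e \<in> ?keys q"
    have "polylog_c r t (\<lambda>j. restrict (\<lambda>j. of_int (k j)) {1..r} j + of_int (Poly_Mapping.lookup (snd e) j)) =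
        multi_polylog r (\<lambda>j. k j + Poly_Mapping.lookup (snd e) j) (of_real t)"
      by (rule polylog_c_of_int) simp
    thus "(case e of (l, m) \<Rightarrow> ?f q l m) = of_int (coeff_a r q e) * des_monom r t e (restrict (\<lambda>j. of_int (k j)) {1..r})"
      by (simp add: des_monom_def case_prod_unfold mult.assoc)
  qed
  finally show ?thesis unfolding inner ..
qed

theorem theorem4p5:
  fixes r :: nat and k :: "nat \<Rightarrow> int" and t :: real
  assumes "r \<ge> 1" and "0 < t" and "t < 1"
  shows "zeta_des r (\<lambda>j. of_int (k j)) t =
    (\<Sum>\<^sub>\<infinity>q::nat. (-1) ^ q * (of_real (ln t) ^ q / fact q) *
       (\<Sum>\<^sub>\<infinity>(l, m)\<in>expos r q.
          of_int (coeff_a r q (l, m)) *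
          (\<Prod>j=1..r. pochhammer (of_int (k j)) (Poly_Mapping.lookup l j)) *
          multi_polylog r (\<lambda>j. k j + Poly_Mapping.lookup m j) (of_real t)))"
proof -
  \<comment> \<open>The degree of G_r in u_r, beyond which the Taylor terms vanish.\<close>
  define d where "d = Max ((\<lambda>e. Poly_Mapping.lookup (fst e) r) ` Poly_Mapping.keys (gen_G r))"
  have d: "\<forall>e\<in>Poly_Mapping.keys (gen_G r). Poly_Mapping.lookup (fst e) r \<le> d"
    unfolding d_def by (intro ballI Max_ge) auto
  show ?thesis
    unfolding zeta_des_of_int[OF assms d] by (rule des_series_restrict_of_int[OF assms(1) d])
qed

end
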